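(* Let $\mathcal{N}(z)$ be a point-to-point LTI network over a field $\mathbb{F}$ with transmitter $tx=0$, relays $1,\dots,v$, receiver $rx=v+1$, channel matrices $H_{i,j}(z)$, and relay gain matrices $K_1,\dots,K_v$ whose entries are pairwise distinct independent indeterminates. Let $G(z,K)$ be its transfer matrix from the transmitter to the receiver. Then $$\operatorname{rank} G(z,K)=\min_{V\subseteq\{0,\dots,v+1\},\ tx\in V,\ rx\notin V}\operatorname{rank} H_{V,V^c}(z).$$
   Context: $\mathbb{F}(z)$ denotes the field of rational functions in $z$ over the field $\mathbb{F}$. A point-to-point LTI network $\mathcal{N}(z)$ with $v$ relays has nodes $tx=0$, $1,\dots,v$, $rx=v+1$. The transmitter has $d_{tx}$ channel inputs, the receiver has $d_{rx}$ channel outputs, relay $i$ has $d_{i,in}$ channel inputs (signals it sends) and $d_{i,out}$ channel outputs (signals it receives). For $i\in\{tx,1,\dots,v\}$ and $j\in\{1,\dots,v,rx\}$ an arbitrary channel matrix $H_{i,j}=H_{i,j}(z)$ with entries in $\mathbb{F}(z)$ from node $i$ to node $j$ is given (size: number of outputs of $j$ times number of inputs of $i$; $i=j$ is allowed for relays). Relay $i$ applies a gain matrix $K_i$ of size $d_{i,in}\times d_{i,out}$; all entries of $K_1,\dots,K_v$ are pairwise distinct, algebraically independent indeterminates over $\mathbb{F}(z)$, collectively denoted $K$. The transfer matrix is $$G(z,K)=H_{tx,rx}+\begin{bmatrix}H_{1,rx}K_1&\cdots&H_{v,rx}K_v\end{bmatrix}\left(I-\begin{bmatrix}H_{1,1}K_1&\cdots&H_{v,1}K_v\\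 \vdots&\ddots&\vdots\\ H_{1,v}K_1&\cdots&H_{v,v}K_v\end{bmatrix}\right)^{-1}\begin{bmatrix}H_{tx,1}\\ \vdots\\ H_{tx,v}\end{bmatrix},$$ a matrix over the rational function field $\mathbb{F}(z,K)$ (the inverse exists over this field). Rank of $G(z,K)$ is over $\mathbb{F}(z,K)$. For $V\subseteq\{0,\dots,v+1\}$ with $tx\in V$, $rx\notin V$, $V^c=\{0,\dots,v+1\}\setminus V$, and $H_{V,V^c}(z)$ is the block matrix with block rows indexed by $j\in V^c$ and block columns indexed by $i\in V$, whose $(j,i)$ block is $H_{i,j}(z)$; its rank is over $\mathbb{F}(z)$. *)

theory Defs
  imports
    "HOL-Library.Poly_Mapping"
    "HOL-Library.Nat_Bijection"
    "HOL-Computational_Algebra.Fraction_Field"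
    "Jordan_Normal_Form.Gauss_Jordan_Elimination"
    "Jordan_Normal_Form.DL_Rank"
begin

type_synonym 'f ratfun = "'f poly fract"

text \<open>
  Rational functions over \<open>'f ratfun\<close> in indeterminates \<open>X\<^sub>0, X\<^sub>1, \<dots>\<close>: a monomial is a finitely
  supported exponent map \<open>nat \<Rightarrow>\<^sub>0 nat\<close>. A network uses only finitely many of the indeterminates;
  the others merely enlarge the field, which affects neither the rank nor the inverse of a matrix
  over the smaller field.
\<close>

type_synonym 'f gain_ratfun = "((nat \<Rightarrow>\<^sub>0 nat) \<Rightarrow>\<^sub>0 'f ratfun) fract"

definition gain_const :: "'f::field ratfun \<Rightarrow> 'f gain_ratfun" where
  "gain_const a = Fract (Poly_Mapping.single 0 a) 1"

definition indet :: "nat \<Rightarrow> 'f::field gain_ratfun" where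
  "indet x = Fract (Poly_Mapping.single (Poly_Mapping.single x 1) 1) 1"

definition mat_rank :: "'a::field mat \<Rightarrow> nat" where
  "mat_rank A = vec_space.rank (dim_row A) A"

text \<open>
  Block matrices. The rows of a block matrix with block rows \<open>js\<close>, block \<open>j\<close> having \<open>d j\<close> rows,
  are enumerated by the pairs (block, row within the block); likewise for the columns.
\<close>

definition block_index :: "(nat \<Rightarrow> nat) \<Rightarrow> nat list \<Rightarrow> (nat \<times> nat) list" where
  "block_index d js = concat (map (\<lambda>j. map (Pair j) [0..<d j]) js)"

definition block_mat ::
    "(nat \<Rightarrow> nat) \<Rightarrow> nat list \<Rightarrow> (nat \<Rightarrow> nat) \<Rightarrow> nat list \<Rightarrow> (nat \<Rightarrow> nat \<Rightarrow> 'a mat) \<Rightarrow> 'a mat" where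
  "block_mat nr js nc is B =
     (let R = block_index nr js; C = block_index nc is in
      mat (length R) (length C)
        (\<lambda>(a, b). let (j, r) = R ! a; (i, c) = C ! b in B j i $$ (r, c)))"

text \<open>
  Node \<open>0\<close> is the transmitter, \<open>1, \<dots>, v\<close> are the relays and \<open>v + 1\<close> is the receiver.
  \<open>d_in i\<close> counts the channel inputs of node \<open>i\<close> (the signals it sends, \<open>i \<le> v\<close>), \<open>d_out j\<close> the
  channel outputs of node \<open>j\<close> (the signals it receives, \<open>1 \<le> j \<le> v + 1\<close>), and \<open>H i j\<close> is the
  channel matrix from node \<open>i\<close> to node \<open>j\<close>.
\<close>

definition lti_network ::
    "nat \<Rightarrow> (nat \<Rightarrow> nat) \<Rightarrow> (nat \<Rightarrow> nat) \<Rightarrow> (nat \<Rightarrow> nat \<Rightarrow> 'f::field ratfun mat) \<Rightarrow> bool" where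
  "lti_network v d_in d_out H \<longleftrightarrow>
     (\<forall>i \<in> {0..v}. \<forall>j \<in> {1..v + 1}. H i j \<in> carrier_mat (d_out j) (d_in i))"

text \<open>Injectivity of \<open>prod_encode\<close> makes all entries of all gain matrices distinct indeterminates.\<close>

definition gain_mat :: "(nat \<Rightarrow> nat) \<Rightarrow> (nat \<Rightarrow> nat) \<Rightarrow> nat \<Rightarrow> 'f::field gain_ratfun mat" where
  "gain_mat d_in d_out i =
     mat (d_in i) (d_out i) (\<lambda>(r, c). indet (prod_encode (i, prod_encode (r, c))))"

text \<open>
  The matrix inverted below is the identity when all indeterminates are set to \<open>0\<close>, hence it is
  invertible and \<open>mat_inverse\<close> does not return \<open>None\<close>.
\<close>

definition transfer_mat ::
    "nat \<Rightarrow> (nat \<Rightarrow> nat) \<Rightarrow> (nat \<Rightarrow> nat) \<Rightarrow> (nat \<Rightarrow> nat \<Rightarrow> 'f::field ratfun mat) \<Rightarrow> 'f gain_ratfun mat" where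
  "transfer_mat v d_in d_out H =
     (let relays = [1..<v + 1];
          H' = (\<lambda>i j. map_mat gain_const (H i j));
          K = gain_mat d_in d_out;
          to_rx = block_mat d_out [v + 1] d_out relays (\<lambda>j i. H' i j * K i);
          loop = block_mat d_out relays d_out relays (\<lambda>j i. H' i j * K i);
          from_tx = block_mat d_out relays d_in [0] (\<lambda>j i. H' i j)
      in H' 0 (v + 1) + to_rx * the (mat_inverse (1\<^sub>m (dim_row loop) - loop)) * from_tx)"

definition cuts :: "nat \<Rightarrow> nat set set" where
  "cuts v = {V. V \<subseteq> {0..v + 1} \<and> 0 \<in> V \<and> v + 1 \<notin> V}"

definition cut_mat ::
    "nat \<Rightarrow> (nat \<Rightarrow> nat) \<Rightarrow> (nat \<Rightarrow> nat) \<Rightarrow> (nat \<Rightarrow> nat \<Rightarrow> 'f::field ratfun mat) \<Rightarrow> nat set \<Rightarrow> 'f ratfun mat" where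
  "cut_mat v d_in d_out H V =
     block_mat d_out (sorted_list_of_set ({0..v + 1} - V)) d_in (sorted_list_of_set V) (\<lambda>j i. H i j)"

end

theory Submission
  imports Defs "Jordan_Normal_Form.Ring_Hom_Matrix"
begin

text \<open>
  The feedback loop is closed one scalar gain \<open>k\<close> at a time. If \<open>k\<close> connects the output \<open>c\<close> to the
  input \<open>r\<close>, every submatrix \<open>R \<times> C\<close> of the transfer matrix of the whole system (all outputs, all
  inputs) changes by a multiple of the column \<open>r\<close> times the row \<open>c\<close>, and because \<open>k\<close> is generic the
  new rank is the smaller one of the old ranks of \<open>(R \<union> {c}) \<times> C\<close> and \<open>R \<times> (C \<union> {r})\<close>. After all gains
  have been closed, the rank at (receiver, transmitter) is therefore a minimum over sets \<open>T\<close> of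
  gains. For a relay \<open>i\<close> either every input of \<open>i\<close> is touched by a gain in \<open>T\<close>, or some input is
  touched only by gains outside \<open>T\<close> and then every output of \<open>i\<close> occurs as a row, so the minimum is
  attained at a cut.
\<close>

section \<open>The rank of a matrix indexed by sets\<close>

text \<open>A factorization through an \<open>n\<close>-dimensional space. Rank as the least inner
  dimension is symmetric in rows and columns, and passing to a submatrix only changes the index
  sets.\<close>

definition factors :: "nat \<Rightarrow> ('i \<Rightarrow> 'j \<Rightarrow> 'a::field) \<Rightarrow> 'i set \<Rightarrow> 'j set \<Rightarrow> bool" where
  "factors n f R C \<longleftrightarrow> (\<exists>u v. \<forall>i\<in>R. \<forall>j\<in>C. f i j = (\<Sum>t<n. u i t * v t j))"

lemma factorsI:
  "(\<And>i j. i \<in> R \<Longrightarrow> j \<in> C \<Longrightarrow> f i j = (\<Sum>t<n. u i t * v t j)) \<Longrightarrow> factors n f R C"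
  unfolding factors_def by blast

definition rank_on :: "('i \<Rightarrow> 'j \<Rightarrow> 'a::field) \<Rightarrow> 'i set \<Rightarrow> 'j set \<Rightarrow> nat" where
  "rank_on f R C = (LEAST n. factors n f R C)"

definition in_col_span :: "('i \<Rightarrow> 'j \<Rightarrow> 'a::field) \<Rightarrow> 'i set \<Rightarrow> 'j set \<Rightarrow> ('i \<Rightarrow> 'a) \<Rightarrow> bool" where
  "in_col_span f R C a \<longleftrightarrow> (\<exists>w. \<forall>i\<in>R. a i = (\<Sum>j\<in>C. f i j * w j))"

lemma in_col_spanI: "\<forall>i\<in>R. a i = (\<Sum>j\<in>C. f i j * w j) \<Longrightarrow> in_col_span f R C a"
  unfolding in_col_span_def by blast

text \<open>An extra summand with index \<open>n\<close> carries the column \<open>j\<close> itself.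
  The old coefficients at \<open>j\<close> are overwritten, which covers the case
  \<open>j \<in> C\<close> as well.\<close>

lemma factors_insert_col:
  fixes f :: "'i \<Rightarrow> 'j \<Rightarrow> 'a::field"
  assumes "factors n f R C"
  shows "factors (Suc n) f R (insert j C)"
proof -
  obtain u v where uv: "\<forall>i\<in>R. \<forall>j\<in>C. f i j = (\<Sum>t<n. u i t * v t j)"
    using assms unfolding factors_def by blast
  define u' where "u' = (\<lambda>i t. if t = n then f i j else u i t)"
  define v' where "v' = (\<lambda>t j'. if j' = j then of_bool (t = n) else if t = n then 0 else v t j')"
  have "\<forall>i\<in>R. \<forall>j'\<in>insert j C. f i j' = (\<Sum>t<Suc n. u' i t * v' t j')"
    using uv by (auto simp: u'_def v'_def)
  then show ?thesis unfolding factors_def by blast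
qed

lemma factors_card:
  assumes "finite C"
  shows "factors (card C) f R C"
  using assms
proof (induction C)
  case empty
  show ?case by (simp add: factors_def)
next
  case (insert j C)
  then show ?case using factors_insert_col[of "card C" f R C j] by simp
qed

lemma factors_mono:
  "factors n f R C \<Longrightarrow> R' \<subseteq> R \<Longrightarrow> C' \<subseteq> C \<Longrightarrow> factors n f R' C'"
  unfolding factors_def by (meson subsetD)

lemma factors_transpose: "factors n (\<lambda>j i. f i j) C R \<longleftrightarrow> factors n f R C"
proof -
  have *: "factors n (\<lambda>j i. f i j) C R" if A: "factors n f R C"
  proof -
    obtain u v where "\<forall>i\<in>R. \<forall>j\<in>C. f i j = (\<Sum>t<n. u i t * v t j)"
      using A unfolding factors_def by blast
    then have "\<forall>j\<in>C. \<forall>i\<in>R. f i j = (\<Sum>t<n. v t j * u i t)" by (simp add: mult.commute)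
    then show ?thesis by (intro factorsI[where u = "\<lambda>j t. v t j" and v = "\<lambda>t i. u i t"]) auto
  qed
  have "factors n f R C" if A: "factors n (\<lambda>j i. f i j) C R"
  proof -
    obtain u v where "\<forall>j\<in>C. \<forall>i\<in>R. f i j = (\<Sum>t<n. u j t * v t i)"
      using A unfolding factors_def by blast
    then have "\<forall>i\<in>R. \<forall>j\<in>C. f i j = (\<Sum>t<n. v t i * u j t)" by (simp add: mult.commute)
    then show ?thesis by (intro factorsI[where u = "\<lambda>j t. v t j" and v = "\<lambda>t i. u i t"]) auto
  qed
  with * show ?thesis by blast
qed

lemma rank_on_le: "factors n f R C \<Longrightarrow> rank_on f R C \<le> n"
  unfolding rank_on_def by (rule Least_le)

lemma factors_rank_on: "finite C \<Longrightarrow> factors (rank_on f R C) f R C"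
  unfolding rank_on_def by (rule LeastI) (rule factors_card)

lemma rank_on_empty: "rank_on f R {} = 0"
proof -
  have "factors 0 f R {}" by (simp add: factors_def)
  then show ?thesis using rank_on_le by fastforce
qed

lemma rank_on_transpose: "rank_on (\<lambda>j i. f i j) C R = rank_on f R C"
  unfolding rank_on_def by (rule arg_cong[where f = Least]) (rule ext, rule factors_transpose)

lemma rank_on_mono:
  assumes "finite C" "R' \<subseteq> R" "C' \<subseteq> C"
  shows "rank_on f R' C' \<le> rank_on f R C"
  by (rule rank_on_le, rule factors_mono[OF factors_rank_on[OF assms(1)] assms(2,3)])

lemma rank_on_cong:
  assumes "\<And>i j. i \<in> R \<Longrightarrow> j \<in> C \<Longrightarrow> f i j = g i j"
  shows "rank_on f R C = rank_on g R C"
  unfolding rank_on_def factors_def using assms by simp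

text \<open>Repeated rows and columns do not change the rank, so \<open>p\<close> and
  \<open>q\<close> may fail to be injective; \<open>inv_into\<close> picks one representative of
  each fibre.\<close>

lemma rank_on_reindex:
  assumes "finite C"
  shows "rank_on (\<lambda>i j. f (p i) (q j)) R C = rank_on f (p ` R) (q ` C)"
proof (rule antisym)
  have "factors (rank_on f (p ` R) (q ` C)) f (p ` R) (q ` C)"
    by (rule factors_rank_on) (rule finite_imageI, fact)
  then obtain u v where uv: "\<And>i j. i \<in> p ` R \<Longrightarrow> j \<in> q ` C \<Longrightarrow>
      f i j = (\<Sum>t<rank_on f (p ` R) (q ` C). u i t * v t j)"
    unfolding factors_def by blast
  show "rank_on (\<lambda>i j. f (p i) (q j)) R C \<le> rank_on f (p ` R) (q ` C)"
    by (rule rank_on_le, rule factorsI, rule uv) (rule imageI, assumption)+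
next
  define n where "n = rank_on (\<lambda>i j. f (p i) (q j)) R C"
  have "factors n (\<lambda>i j. f (p i) (q j)) R C"
    unfolding n_def by (rule factors_rank_on) fact
  then obtain u v where uv: "\<And>i j. i \<in> R \<Longrightarrow> j \<in> C \<Longrightarrow> f (p i) (q j) = (\<Sum>t<n. u i t * v t j)"
    unfolding factors_def by blast
  have "f i j = (\<Sum>t<n. u (inv_into R p i) t * v t (inv_into C q j))" if "i \<in> p ` R" "j \<in> q ` C" for i j
    using uv[OF inv_into_into[OF that(1)] inv_into_into[OF that(2)]]
    unfolding f_inv_into_f[OF that(1)] f_inv_into_f[OF that(2)] .
  then have "factors n f (p ` R) (q ` C)" by (rule factorsI)
  then show "rank_on f (p ` R) (q ` C) \<le> rank_on (\<lambda>i j. f (p i) (q j)) R C"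
    unfolding n_def by (rule rank_on_le)
qed

section \<open>Column spans and the effect of one more column on the rank\<close>

text \<open>Induction on the columns. If column \<open>j\<close> depends on the others, a functional
  that kills them kills it too. Otherwise the induction hypothesis is used twice: once to separate
  column \<open>j\<close> from \<open>C\<close>, and once for \<open>a\<close> with its part along
  column \<open>j\<close> removed.\<close>

lemma Fredholm_alternative:
  fixes f :: "'i \<Rightarrow> 'j \<Rightarrow> 'a::field"
  assumes "finite R" "finite C" "\<not> in_col_span f R C a"
  shows "\<exists>y. (\<forall>j\<in>C. (\<Sum>i\<in>R. y i * f i j) = 0) \<and> (\<Sum>i\<in>R. y i * a i) = 1"
  using assms(2,3)
proof (induction C arbitrary: a)
  case empty
  then obtain i where i: "i \<in> R" "a i \<noteq> 0" by (auto simp: in_col_span_def)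
  have "(\<Sum>l\<in>R. (if l = i then inverse (a i) else 0) * a l) = (\<Sum>l\<in>R. if l = i then 1 else 0)"
    by (rule sum.cong) (use i in auto)
  also have "\<dots> = 1" using i assms(1) by simp
  finally show ?case by auto
next
  case (insert j C)
  show ?case
  proof (cases "in_col_span f R C (\<lambda>i. f i j)")
    case True
    then obtain w where w: "\<forall>i\<in>R. f i j = (\<Sum>l\<in>C. f i l * w l)" by (auto simp: in_col_span_def)
    have "\<not> in_col_span f R C a"
    proof
      assume "in_col_span f R C a"
      then obtain w' where "\<forall>i\<in>R. a i = (\<Sum>l\<in>C. f i l * w' l)" by (auto simp: in_col_span_def)
      then have "\<forall>i\<in>R. a i = (\<Sum>l\<in>insert j C. f i l * (w'(j := 0)) l)"
        using insert(1,2) by (auto intro: sum.cong)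
      then show False using insert.prems unfolding in_col_span_def by blast
    qed
    then obtain y where y: "\<forall>l\<in>C. (\<Sum>i\<in>R. y i * f i l) = 0" "(\<Sum>i\<in>R. y i * a i) = 1"
      using insert.IH by blast
    have "(\<Sum>i\<in>R. y i * f i j) = (\<Sum>i\<in>R. \<Sum>l\<in>C. y i * f i l * w l)"
      by (rule sum.cong) (use w in \<open>auto simp: sum_distrib_left mult.assoc\<close>)
    also have "\<dots> = (\<Sum>l\<in>C. (\<Sum>i\<in>R. y i * f i l) * w l)"
      by (subst sum.swap) (simp add: sum_distrib_right)
    also have "\<dots> = 0" using y by simp
    finally show ?thesis using y by auto
  next
    case False
    then obtain y0 where y0: "\<forall>l\<in>C. (\<Sum>i\<in>R. y0 i * f i l) = 0" "(\<Sum>i\<in>R. y0 i * f i j) = 1"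
      using insert.IH by blast
    \<comment> \<open>Since \<open>y0\<close> kills the columns in \<open>C\<close>,
      \<open>b\<close> is the only coefficient that column \<open>j\<close> can have in a
      representation of \<open>a\<close>.\<close>
    define b where "b = (\<Sum>i\<in>R. y0 i * a i)"
    have "\<not> in_col_span f R C (\<lambda>i. a i - b * f i j)"
    proof
      assume "in_col_span f R C (\<lambda>i. a i - b * f i j)"
      then obtain w where w: "\<forall>i\<in>R. a i - b * f i j = (\<Sum>l\<in>C. f i l * w l)"
        by (auto simp: in_col_span_def)
      have "\<forall>i\<in>R. a i = (\<Sum>l\<in>insert j C. f i l * (w(j := b)) l)"
      proof
        fix i assume "i \<in> R"
        have "(\<Sum>l\<in>C. f i l * (w(j := b)) l) = (\<Sum>l\<in>C. f i l * w l)"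
          using insert(2) by (auto intro: sum.cong)
        then show "a i = (\<Sum>l\<in>insert j C. f i l * (w(j := b)) l)"
          using insert(1,2) w[rule_format, OF \<open>i \<in> R\<close>] by (simp add: algebra_simps)
      qed
      then show False using insert.prems unfolding in_col_span_def by blast
    qed
    then obtain y where y: "\<forall>l\<in>C. (\<Sum>i\<in>R. y i * f i l) = 0" "(\<Sum>i\<in>R. y i * (a i - b * f i j)) = 1"
      using insert.IH by blast
    \<comment> \<open>Subtracting \<open>e\<close> times \<open>y0\<close> makes the functional
      vanish on column \<open>j\<close>; its value on \<open>a\<close> becomes the value of
      \<open>y\<close> on \<open>a\<close> minus \<open>b\<close> times column \<open>j\<close>,
      which is 1.\<close>
    define e where "e = (\<Sum>i\<in>R. y i * f i j)"
    have comb: "(\<Sum>i\<in>R. (y i - e * y0 i) * g i) = (\<Sum>i\<in>R. y i * g i) - e * (\<Sum>i\<in>R. y0 i * g i)" for g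
      by (simp add: left_diff_distrib sum_subtractf sum_distrib_left mult.assoc)
    have "(\<Sum>i\<in>R. y i * (a i - b * f i j)) = (\<Sum>i\<in>R. y i * a i) - b * e"
      by (simp add: right_diff_distrib sum_subtractf sum_distrib_left e_def mult.left_commute)
    then have "(\<Sum>i\<in>R. (y i - e * y0 i) * a i) = 1"
      using y(2) comb[of a] b_def by (simp add: mult.commute)
    moreover have "\<forall>l\<in>insert j C. (\<Sum>i\<in>R. (y i - e * y0 i) * f i l) = 0"
      using y(1) y0 comb by (auto simp: e_def)
    ultimately show ?thesis by (intro exI[of _ "\<lambda>i. y i - e * y0 i"]) simp
  qed
qed

text \<open>Combining columns acts only on the second factor of a factorization and keeps the inner
  dimension.\<close>

lemma rank_on_add_span:
  fixes f g :: "'i \<Rightarrow> 'j \<Rightarrow> 'a::field"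
  assumes "finite C" "\<And>j. j \<in> C' \<Longrightarrow> in_col_span f R C (\<lambda>i. g i j)"
  shows "rank_on g R C' \<le> rank_on f R C"
proof (rule rank_on_le)
  define n where "n = rank_on f R C"
  have "factors n f R C" unfolding n_def by (rule factors_rank_on) fact
  then obtain u v where uv: "\<forall>i\<in>R. \<forall>j\<in>C. f i j = (\<Sum>t<n. u i t * v t j)"
    unfolding factors_def by blast
  obtain w where w: "\<And>i j. j \<in> C' \<Longrightarrow> i \<in> R \<Longrightarrow> g i j = (\<Sum>l\<in>C. f i l * w j l)"
  proof -
    have "\<forall>j\<in>C'. \<exists>w. \<forall>i\<in>R. g i j = (\<Sum>l\<in>C. f i l * w l)"
      using assms(2) unfolding in_col_span_def by blast
    from bchoice[OF this] show ?thesis using that by blast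
  qed
  have "g i j = (\<Sum>t<n. u i t * (\<Sum>l\<in>C. v t l * w j l))" if "i \<in> R" "j \<in> C'" for i j
  proof -
    have "g i j = (\<Sum>l\<in>C. \<Sum>t<n. u i t * v t l * w j l)"
      unfolding w[OF that(2,1)] by (rule sum.cong) (use uv that(1) in \<open>auto simp: sum_distrib_right\<close>)
    also have "\<dots> = (\<Sum>t<n. u i t * (\<Sum>l\<in>C. v t l * w j l))"
      by (subst sum.swap) (simp add: sum_distrib_left mult.assoc)
    finally show ?thesis .
  qed
  then have "factors n g R C'" by (rule factorsI)
  then show "factors (rank_on f R C) g R C'" unfolding n_def .
qed

lemma in_col_span_member:
  fixes f :: "'i \<Rightarrow> 'j \<Rightarrow> 'a::field"
  shows "finite C \<Longrightarrow> j \<in> C \<Longrightarrow> in_col_span f R C (\<lambda>i. f i j)"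
  by (rule in_col_spanI[where w = "\<lambda>l. if l = j then 1 else 0"]) (simp add: if_distrib[of "\<lambda>x. _ * x"] cong: if_cong)

lemma rank_on_insert_in_span:
  fixes f :: "'i \<Rightarrow> 'j \<Rightarrow> 'a::field"
  assumes "finite C" "in_col_span f R C (\<lambda>i. f i j)"
  shows "rank_on f R (insert j C) = rank_on f R C"
proof (rule antisym)
  show "rank_on f R (insert j C) \<le> rank_on f R C"
    by (rule rank_on_add_span) (use assms in_col_span_member in auto)
qed (use assms in \<open>auto intro: rank_on_mono\<close>)

text \<open>For the lower bound, a functional that kills \<open>C\<close> but not column
  \<open>j\<close> is applied to a factorization of the enlarged matrix. This yields a nontrivial
  linear relation among the rows of \<open>v\<close> restricted to \<open>C\<close>, and one summand
  can be eliminated there.\<close>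

lemma rank_on_insert_not_in_span:
  fixes f :: "'i \<Rightarrow> 'j \<Rightarrow> 'a::field"
  assumes "finite R" "finite C" "\<not> in_col_span f R C (\<lambda>i. f i j)"
  shows "rank_on f R (insert j C) = Suc (rank_on f R C)"
proof (rule antisym)
  show "rank_on f R (insert j C) \<le> Suc (rank_on f R C)"
    by (rule rank_on_le) (rule factors_insert_col, rule factors_rank_on, fact)
  let ?n = "rank_on f R (insert j C)"
  obtain y where y: "\<forall>l\<in>C. (\<Sum>i\<in>R. y i * f i l) = 0" "(\<Sum>i\<in>R. y i * f i j) = 1"
    using Fredholm_alternative[OF assms] by blast
  obtain u v where uv: "\<forall>i\<in>R. \<forall>l\<in>insert j C. f i l = (\<Sum>t<?n. u i t * v t l)"
    using factors_rank_on[of "insert j C" f R] assms(2) unfolding factors_def by blast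
  define \<alpha> where "\<alpha> = (\<lambda>t. \<Sum>i\<in>R. y i * u i t)"
  have \<alpha>: "(\<Sum>t<?n. \<alpha> t * v t l) = (\<Sum>i\<in>R. y i * f i l)" if "l \<in> insert j C" for l
  proof -
    have "(\<Sum>i\<in>R. y i * f i l) = (\<Sum>i\<in>R. \<Sum>t<?n. y i * u i t * v t l)"
      by (intro sum.cong) (use uv that in \<open>auto simp: sum_distrib_left mult.assoc\<close>)
    also have "\<dots> = (\<Sum>t<?n. \<alpha> t * v t l)"
      by (subst sum.swap) (simp add: \<alpha>_def sum_distrib_right)
    finally show ?thesis ..
  qed
  obtain t0 where t0: "t0 < ?n" "\<alpha> t0 \<noteq> 0"
  proof -
    have "\<exists>t\<in>{..<?n}. \<alpha> t * v t j \<noteq> 0"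
    proof (rule ccontr)
      assume "\<not> ?thesis"
      then have "(\<Sum>t<?n. \<alpha> t * v t j) = 0" by (intro sum.neutral) blast
      then show False using \<alpha>[of j] y(2) by simp
    qed
    then show ?thesis using that by auto
  qed
  define \<pi> where "\<pi> = (\<lambda>t. if t < t0 then t else Suc t)"
  have bij: "bij_betw \<pi> {..<?n - 1} ({..<?n} - {t0})"
  proof (rule bij_betwI[where g = "\<lambda>t. if t < t0 then t else t - 1"])
  qed (use t0 in \<open>auto simp: \<pi>_def split: if_splits\<close>)
  \<comment> \<open>Dividing the relation by \<open>\<alpha> t0\<close> expresses row
    \<open>t0\<close> of \<open>v\<close> on \<open>C\<close> through the other rows; substituting
    it leaves the indices enumerated by \<open>\<pi>\<close>.\<close>
  have "f i l = (\<Sum>t<?n - 1. (u i (\<pi> t) - \<alpha> (\<pi> t) / \<alpha> t0 * u i t0) * v (\<pi> t) l)"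
    if "i \<in> R" "l \<in> C" for i l
  proof -
    have "(\<Sum>t<?n - 1. (u i (\<pi> t) - \<alpha> (\<pi> t) / \<alpha> t0 * u i t0) * v (\<pi> t) l)
        = (\<Sum>t\<in>{..<?n} - {t0}. (u i t - \<alpha> t / \<alpha> t0 * u i t0) * v t l)"
      by (rule sum.reindex_bij_betw[OF bij])
    also have "\<dots> = (\<Sum>t<?n. (u i t - \<alpha> t / \<alpha> t0 * u i t0) * v t l)"
      by (rule sum.mono_neutral_left) (use t0 in auto)
    also have "\<dots> = (\<Sum>t<?n. u i t * v t l) - u i t0 / \<alpha> t0 * (\<Sum>t<?n. \<alpha> t * v t l)"
      unfolding sum_distrib_left sum_subtractf[symmetric]
      by (intro sum.cong) (simp_all add: left_diff_distrib)
    also have "\<dots> = f i l" using \<alpha>[of l] y(1) uv that by auto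
    finally show ?thesis ..
  qed
  then have "factors (?n - 1) f R C"
    by (intro factorsI[where u = "\<lambda>i t. u i (\<pi> t) - \<alpha> (\<pi> t) / \<alpha> t0 * u i t0" and v = "\<lambda>t. v (\<pi> t)"]) auto
  then have "rank_on f R C \<le> ?n - 1" by (rule rank_on_le)
  then show "Suc (rank_on f R C) \<le> ?n" using t0 by linarith
qed

section \<open>Invariance of the rank under field extension\<close>

text \<open>A linear system that is unsolvable over the small field has a certificate
  \<open>y\<close> of unsolvability there, and the image of \<open>y\<close> is a certificate over
  the large field.\<close>

lemma (in field_hom) in_col_span_hom_iff:
  fixes f :: "'i \<Rightarrow> 'j \<Rightarrow> 'a"
  assumes "finite R" "finite C"
  shows "in_col_span (\<lambda>i j. hom (f i j)) R C (\<lambda>i. hom (a i)) \<longleftrightarrow> in_col_span f R C a"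
proof
  assume "in_col_span f R C a"
  then obtain w where "\<forall>i\<in>R. a i = (\<Sum>j\<in>C. f i j * w j)" by (auto simp: in_col_span_def)
  then have "\<forall>i\<in>R. hom (a i) = (\<Sum>j\<in>C. hom (f i j) * hom (w j))" by (simp add: hom_sum hom_mult)
  then show "in_col_span (\<lambda>i j. hom (f i j)) R C (\<lambda>i. hom (a i))"
    by (rule in_col_spanI)
next
  assume L: "in_col_span (\<lambda>i j. hom (f i j)) R C (\<lambda>i. hom (a i))"
  then obtain w where w: "\<forall>i\<in>R. hom (a i) = (\<Sum>j\<in>C. hom (f i j) * w j)" by (auto simp: in_col_span_def)
  show "in_col_span f R C a"
  proof (rule ccontr)
    assume "\<not> in_col_span f R C a"
    then obtain y where y: "\<forall>j\<in>C. (\<Sum>i\<in>R. y i * f i j) = 0" "(\<Sum>i\<in>R. y i * a i) = 1"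
      using Fredholm_alternative[OF assms] by blast
    have "1 = hom (\<Sum>i\<in>R. y i * a i)" using y by simp
    also have "\<dots> = (\<Sum>i\<in>R. \<Sum>j\<in>C. hom (y i * f i j) * w j)"
      by (simp add: hom_sum hom_mult w sum_distrib_left mult.assoc)
    also have "\<dots> = (\<Sum>j\<in>C. hom (\<Sum>i\<in>R. y i * f i j) * w j)"
      by (subst sum.swap) (simp add: hom_sum sum_distrib_right)
    also have "\<dots> = 0" using y by simp
    finally show False by simp
  qed
qed

text \<open>Built up column by column, both ranks grow at the same columns. This allows ranks of
  cuts to be computed over the field that contains the gains.\<close>

lemma (in field_hom) rank_on_hom:
  fixes f :: "'i \<Rightarrow> 'j \<Rightarrow> 'a"
  assumes "finite R" "finite C"
  shows "rank_on (\<lambda>i j. hom (f i j)) R C = rank_on f R C"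
  using assms(2)
proof (induction C)
  case empty
  show ?case by (simp add: rank_on_empty)
next
  case (insert j C)
  then show ?case
    using assms(1) in_col_span_hom_iff[of R C f "\<lambda>i. f i j"]
    by (cases "in_col_span f R C (\<lambda>i. f i j)")
      (simp_all add: rank_on_insert_in_span rank_on_insert_not_in_span)
qed

section \<open>Agreement with the rank of matrices\<close>

text \<open>\<open>mat_rank\<close> is the size of a maximal independent set \<open>S\<close> of
  columns. Adding the vectors of \<open>S\<close> one by one raises \<open>rank_on\<close> by one
  each time, and all other columns lie in the span of \<open>S\<close>.\<close>

lemma mat_rank_eq_rank_on:
  fixes A :: "'a::field mat"
  shows "mat_rank A = rank_on (\<lambda>i j. A $$ (i, j)) {..<dim_row A} {..<dim_col A}"
proof -
  define n where "n = dim_row A"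
  interpret vec_space "TYPE('a)" n .
  \<comment> \<open>Column vectors serve as their own column indices. Equal columns of
    \<open>A\<close> are thereby merged, which \<open>rank_on_reindex\<close> undoes at the
    end.\<close>
  let ?g = "\<lambda>i (x :: 'a vec). x $ i"
  have A: "A \<in> carrier_mat n (dim_col A)" unfolding n_def by (rule carrier_matI) simp_all
  have cols: "set (cols A) \<subseteq> carrier_vec n" unfolding n_def by (rule cols_dim)
  have span: "x \<in> span X \<longleftrightarrow> in_col_span ?g {..<n} X (\<lambda>i. x $ i)"
    if X: "finite X" "X \<subseteq> carrier_vec n" and x: "x \<in> carrier_vec n" for x X
  proof
    assume "x \<in> span X"
    then obtain a where a: "x = lincomb a X" using finite_in_span[OF X] by blast
    show "in_col_span ?g {..<n} X (\<lambda>i. x $ i)"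
      by (rule in_col_spanI[where w = a]) (auto simp: a lincomb_index[OF _ X(2)] mult.commute)
  next
    assume "in_col_span ?g {..<n} X (\<lambda>i. x $ i)"
    then obtain w where w: "\<forall>i\<in>{..<n}. x $ i = (\<Sum>y\<in>X. y $ i * w y)" unfolding in_col_span_def by blast
    have "x = lincomb w X"
    proof (rule eq_vecI)
      show "dim_vec x = dim_vec (lincomb w X)" using lincomb_dim[OF X] x by auto
      fix i assume "i < dim_vec (lincomb w X)"
      then have "i < n" using lincomb_dim[OF X] by auto
      then show "x $ i = lincomb w X $ i" using w lincomb_index[OF _ X(2)] by (simp add: mult.commute)
    qed
    then show "x \<in> span X" using X unfolding span_def by blast
  qed
  have indpt: "rank_on ?g {..<n} X = card X" if "finite X" "X \<subseteq> carrier_vec n" "lin_indpt X" for X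
    using that
  proof (induction X)
    case empty
    show ?case by (simp add: rank_on_empty)
  next
    case (insert x X)
    have li: "lin_indpt X" using insert.prems(2) subset_li_is_li[of "insert x X" X] by auto
    have "x \<notin> span X"
      using lin_dep_iff_in_span[of X x] insert.prems insert.hyps li by auto
    then have "\<not> in_col_span ?g {..<n} X (\<lambda>i. x $ i)"
      using span[of X x] insert by auto
    then show ?case
      using rank_on_insert_not_in_span[of "{..<n}" X ?g x] insert li by simp
  qed
  obtain S where S: "maximal S (\<lambda>T. T \<subseteq> set (cols A) \<and> lin_indpt T)" "finite S"
    using maximal_exists_superset[of "set (cols A)" "\<lambda>T. T \<subseteq> set (cols A) \<and> lin_indpt T" "{}"]
    by (metis (no_types, lifting) List.finite_set empty_subsetI finite_lin_indpt2 equals0D finite.emptyI)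
  then have S': "S \<subseteq> set (cols A)" "lin_indpt S" "S \<subseteq> carrier_vec n" using cols by (auto simp: maximal_def)
  have "rank_on ?g {..<n} (set (cols A)) = rank_on ?g {..<n} S"
  proof (rule antisym)
    show "rank_on ?g {..<n} (set (cols A)) \<le> rank_on ?g {..<n} S"
    proof (rule rank_on_add_span[OF S(2)])
      fix x assume x: "x \<in> set (cols A)"
      have "x \<in> span S"
      proof (cases "x \<in> S")
        case True
        then show ?thesis using S' span_mem by blast
      next
        case False
        then have "lin_dep (insert x S)" using S x unfolding maximal_def by blast
        then show ?thesis using lin_dep_iff_in_span[of S x] S' x cols False by auto
      qed
      then show "in_col_span ?g {..<n} S (\<lambda>i. x $ i)" using span[OF S(2) S'(3)] x cols by blast
    qed
  qed (use S' in \<open>auto intro: rank_on_mono\<close>)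
  also have "\<dots> = card S" using indpt S(2) S' by blast
  also have "\<dots> = mat_rank A" unfolding mat_rank_def n_def[symmetric]
    by (rule rank_card_indpt[OF A S(1), symmetric])
  finally have "mat_rank A = rank_on ?g {..<n} (set (cols A))" ..
  also have "set (cols A) = col A ` {..<dim_col A}"
    by (auto simp: cols_def)
  also have "rank_on ?g {..<n} (col A ` {..<dim_col A}) = rank_on (\<lambda>i j. col A j $ i) {..<n} {..<dim_col A}"
    using rank_on_reindex[of "{..<dim_col A}" ?g id "col A" "{..<n}"] by simp
  also have "\<dots> = rank_on (\<lambda>i j. A $$ (i, j)) {..<n} {..<dim_col A}"
    by (rule rank_on_cong) (auto simp: n_def)
  finally show ?thesis by (simp add: n_def)
qed

definition mat_on :: "('i \<Rightarrow> 'j \<Rightarrow> 'a) \<Rightarrow> 'i list \<Rightarrow> 'j list \<Rightarrow> 'a mat" where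
  "mat_on f R C = mat (length R) (length C) (\<lambda>(a, b). f (R ! a) (C ! b))"

lemma dim_mat_on [simp]: "dim_row (mat_on f R C) = length R" "dim_col (mat_on f R C) = length C"
  by (simp_all add: mat_on_def)

lemma mat_on_carrier [simp]: "mat_on f R C \<in> carrier_mat (length R) (length C)"
  by (simp add: mat_on_def)

lemma index_mat_on [simp]:
  "a < length R \<Longrightarrow> b < length C \<Longrightarrow> mat_on f R C $$ (a, b) = f (R ! a) (C ! b)"
  by (simp add: mat_on_def)

lemma mat_on_cong:
  assumes "\<And>i j. i \<in> set R \<Longrightarrow> j \<in> set C \<Longrightarrow> f i j = g i j"
  shows "mat_on f R C = mat_on g R C"
  by (rule eq_matI) (use assms in auto)

lemma mat_on_add: "mat_on (\<lambda>i j. f i j + g i j) R C = mat_on f R C + mat_on g R C"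
  by (rule eq_matI) auto

text \<open>The matrix product sums over positions in \<open>U\<close>; distinctness turns this into
  a sum over the set.\<close>

lemma mat_on_mult:
  fixes f :: "'i \<Rightarrow> 'k \<Rightarrow> 'a::comm_semiring_0"
  assumes "distinct U"
  shows "mat_on f R U * mat_on g U C = mat_on (\<lambda>i j. \<Sum>u\<in>set U. f i u * g u j) R C"
proof (rule eq_matI)
  fix a b assume "a < dim_row (mat_on (\<lambda>i j. \<Sum>u\<in>set U. f i u * g u j) R C)"
    "b < dim_col (mat_on (\<lambda>i j. \<Sum>u\<in>set U. f i u * g u j) R C)"
  then have ab: "a < length R" "b < length C" by simp_all
  have "(mat_on f R U * mat_on g U C) $$ (a, b) = (\<Sum>l = 0..<length U. f (R ! a) (U ! l) * g (U ! l) (C ! b))"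
    using ab by (auto simp: scalar_prod_def intro!: sum.cong)
  also have "\<dots> = (\<Sum>u\<in>set U. f (R ! a) u * g u (C ! b))"
    by (rule sum.reindex_bij_betw) (use bij_betw_nth[OF assms refl refl] in \<open>simp add: atLeast0LessThan\<close>)
  finally show "(mat_on f R U * mat_on g U C) $$ (a, b) = mat_on (\<lambda>i j. \<Sum>u\<in>set U. f i u * g u j) R C $$ (a, b)"
    using ab by simp
qed simp_all

lemma mat_rank_mat_on: "mat_rank (mat_on f R C) = rank_on f (set R) (set C)"
proof -
  have img: "(!) xs ` {..<length xs} = set xs" for xs :: "'z list" by (auto simp: set_conv_nth)
  have "mat_rank (mat_on f R C) = rank_on (\<lambda>a b. f (R ! a) (C ! b)) {..<length R} {..<length C}"
    unfolding mat_rank_eq_rank_on by (simp, rule rank_on_cong) simp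
  also have "\<dots> = rank_on f (set R) (set C)"
    by (subst rank_on_reindex[where p = "(!) R" and q = "(!) C"]) (simp_all add: img)
  finally show ?thesis .
qed

section \<open>Closing a generic gain\<close>

text \<open>Feedback with gain \<open>k\<close> from the output \<open>c\<close> to the input \<open>r\<close> of the system with transfer function \<open>f\<close>.\<close>

definition close_gain :: "'a::field \<Rightarrow> 'i \<Rightarrow> 'j \<Rightarrow> ('i \<Rightarrow> 'j \<Rightarrow> 'a) \<Rightarrow> 'i \<Rightarrow> 'j \<Rightarrow> 'a" where
  "close_gain k c r f = (\<lambda>i j. f i j + f i r * (k / (1 - k * f c r)) * f c j)"

text \<open>Closing a gain adds a multiple of column \<open>r\<close> to every column. The new
  columns lie in the span of the old ones once \<open>r\<close> is among them.\<close>

lemma rank_on_add_col_multiples: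
  fixes f g :: "'i \<Rightarrow> 'j \<Rightarrow> 'a::field"
  assumes "finite C" "r \<in> C" "\<And>i j. i \<in> R \<Longrightarrow> j \<in> C' \<Longrightarrow> g i j = f i j + f i r * t j" "C' \<subseteq> C"
  shows "rank_on g R C' \<le> rank_on f R C"
proof (rule rank_on_add_span[OF assms(1)])
  fix j assume j: "j \<in> C'"
  have "g i j = (\<Sum>l\<in>C. f i l * ((if l = j then 1 else 0) + (if l = r then t j else 0)))" if "i \<in> R" for i
  proof -
    have "(\<Sum>l\<in>C. f i l * ((if l = j then 1 else 0) + (if l = r then t j else 0)))
      = (\<Sum>l\<in>C. if l = j then f i l else 0) + (\<Sum>l\<in>C. if l = r then f i l * t j else 0)"
      unfolding sum.distrib[symmetric] by (rule sum.cong) (auto simp: distrib_left)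
    also have "\<dots> = f i j + f i r * t j" using assms j by (auto simp: sum.delta)
    finally show ?thesis using assms(3)[OF that j] by simp
  qed
  then show "in_col_span f R C (\<lambda>i. g i j)" by (intro in_col_spanI) (rule ballI)
qed

lemma rank_on_close_gain_le_col:
  assumes "finite C"
  shows "rank_on (close_gain k c r f) R C \<le> rank_on f R (insert r C)"
  by (rule rank_on_add_col_multiples[where r = r and t = "\<lambda>j. k / (1 - k * f c r) * f c j"])
    (use assms in \<open>auto simp: close_gain_def\<close>)

text \<open>Transposition exchanges the roles of \<open>c\<close> and \<open>r\<close>, so each
  statement about rows follows from the one about columns.\<close>

lemma close_gain_transpose: "close_gain k r c (\<lambda>j i. f i j) = (\<lambda>j i. close_gain k c r f i j)"
  by (simp add: close_gain_def fun_eq_iff)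

lemma rank_on_close_gain_le_row:
  assumes "finite R"
  shows "rank_on (close_gain k c r f) R C \<le> rank_on f (insert c R) C"
proof -
  have "rank_on (close_gain k c r f) R C = rank_on (\<lambda>j i. close_gain k c r f i j) C R"
    by (rule rank_on_transpose[symmetric])
  also have "\<dots> = rank_on (close_gain k r c (\<lambda>j i. f i j)) C R"
    by (subst close_gain_transpose) (rule refl)
  also have "\<dots> \<le> rank_on (\<lambda>j i. f i j) C (insert c R)"
    by (rule rank_on_close_gain_le_col) fact
  also have "\<dots> = rank_on f (insert c R) C"
    by (rule rank_on_transpose)
  finally show ?thesis .
qed

lemma close_gain_col:
  assumes "1 - k * f c r \<noteq> 0"
  shows "close_gain k c r f i r = f i r / (1 - k * f c r)"
  using assms by (simp add: close_gain_def field_simps)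

lemma close_gain_row:
  assumes "1 - k * f c r \<noteq> 0"
  shows "close_gain k c r f c j = f c j / (1 - k * f c r)"
  using assms by (simp add: close_gain_def field_simps)

text \<open>Feedback with gain \<open>- k\<close> cancels feedback with gain \<open>k\<close>.
  Inequalities between the ranks before and after closing therefore become equalities when
  \<open>r\<close> is among the columns or \<open>c\<close> among the rows.\<close>

lemma close_gain_inverse:
  assumes "1 - k * f c r \<noteq> 0"
  shows "close_gain (- k) c r (close_gain k c r f) = f"
proof -
  let ?d = "1 - k * f c r" and ?g = "close_gain k c r f"
  have d: "1 - - k * ?g c r = 1 / ?d"
    unfolding close_gain_col[of k f, OF assms] using assms by (simp add: field_simps)
  have "close_gain (- k) c r ?g i j = f i j" for i j
  proof -
    have "close_gain (- k) c r ?g i j = ?g i j + ?g i r * (- k * ?d) * ?g c j"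
      unfolding close_gain_def[of "- k"] d by simp
    also have "\<dots> = ?g i j - f i r * (k / ?d) * f c j"
      unfolding close_gain_row[of k f, OF assms] close_gain_col[of k f, OF assms] using assms by simp
    also have "\<dots> = f i j" by (simp add: close_gain_def)
    finally show ?thesis .
  qed
  then show ?thesis by blast
qed

lemma rank_on_close_gain_insert_col:
  assumes "finite C" "1 - k * f c r \<noteq> 0"
  shows "rank_on (close_gain k c r f) R (insert r C) = rank_on f R (insert r C)"
  using rank_on_close_gain_le_col[of "insert r C" k c r f R]
    rank_on_close_gain_le_col[of "insert r C" "- k" c r "close_gain k c r f" R]
    close_gain_inverse[of k f c r] assms by simp

lemma rank_on_close_gain_insert_row:
  assumes "finite R" "1 - k * f c r \<noteq> 0"
  shows "rank_on (close_gain k c r f) (insert c R) C = rank_on f (insert c R) C"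
  using rank_on_close_gain_le_row[of "insert c R" k c r f C]
    rank_on_close_gain_le_row[of "insert c R" "- k" c r "close_gain k c r f" C]
    close_gain_inverse[of k f c r] assms by simp

text \<open>
  A field endomorphism fixing \<open>f\<close> but not \<open>k\<close> stands in for the transcendence of \<open>k\<close> over the
  field generated by the entries of \<open>f\<close>.
\<close>

locale free_gain = field_hom hom for hom :: "'a::field \<Rightarrow> 'a" +
  fixes k :: 'a and c :: 'i and r :: 'j and f :: "'i \<Rightarrow> 'j \<Rightarrow> 'a"
  assumes fixed: "\<And>i j. hom (f i j) = f i j" and moved: "hom k \<noteq> k"
begin

text \<open>Otherwise \<open>k\<close> would be the inverse of a fixed element and hence fixed
  itself.\<close>

lemma mult_neq_1:
  assumes "hom x = x"
  shows "k * x \<noteq> 1"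
proof
  assume kx: "k * x = 1"
  then have "hom k * x = 1" using assms by (metis hom_mult hom_one)
  then have "hom k * x = k * x" "x \<noteq> 0" using kx by auto
  then show False using moved by simp
qed

lemma denom_nonzero: "1 - k * f c r \<noteq> 0"
  using mult_neq_1[OF fixed] by (metis eq_iff_diff_eq_0)

lemma k_nonzero: "k \<noteq> 0"
  using moved by auto

text \<open>The coefficients \<open>u\<close> and \<open>w\<close> may involve \<open>k\<close>.
  Applying \<open>w\<close> to the columns of the closed system gives column \<open>r\<close> up to
  the factor \<open>?d + k * \<theta>\<close>, so this factor has to be nonzero; it is because
  \<open>\<theta>\<close> is fixed by \<open>hom\<close>.\<close>

lemma in_col_span_of_combinations:
  assumes row: "\<And>j. j \<in> C \<Longrightarrow> f c j = (\<Sum>i\<in>R. u i * f i j)"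
    and col: "\<And>i. i \<in> R \<Longrightarrow> f i r = (\<Sum>j\<in>C. f i j * w j)"
  shows "in_col_span (close_gain k c r f) R C (\<lambda>i. close_gain k c r f i r)"
proof -
  let ?g = "close_gain k c r f" and ?d = "1 - k * f c r"
  define \<theta> where "\<theta> = (\<Sum>j\<in>C. f c j * w j)"
  have \<theta>_row: "\<theta> = (\<Sum>i\<in>R. u i * f i r)"
  proof -
    have "\<theta> = (\<Sum>j\<in>C. \<Sum>i\<in>R. u i * f i j * w j)"
      unfolding \<theta>_def by (rule sum.cong) (auto simp: row sum_distrib_right)
    also have "\<dots> = (\<Sum>i\<in>R. u i * f i r)"
      by (subst sum.swap) (auto simp: col sum_distrib_left mult.assoc)
    finally show ?thesis .
  qed
  \<comment> \<open>\<open>hom\<close> carries \<open>w\<close> to another solution of the same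
    system, whose data are fixed. By \<open>\<theta>_row\<close> the value \<open>\<theta>\<close>
    does not depend on the chosen solution.\<close>
  have "hom \<theta> = (\<Sum>j\<in>C. f c j * hom (w j))"
    unfolding \<theta>_def by (simp add: hom_sum hom_mult fixed)
  also have "\<dots> = (\<Sum>j\<in>C. \<Sum>i\<in>R. u i * f i j * hom (w j))"
    by (rule sum.cong) (auto simp: row sum_distrib_right)
  also have "\<dots> = (\<Sum>i\<in>R. u i * (\<Sum>j\<in>C. f i j * hom (w j)))"
    by (subst sum.swap) (auto simp: sum_distrib_left mult.assoc)
  also have "\<dots> = (\<Sum>i\<in>R. u i * f i r)"
  proof (rule sum.cong)
    fix i assume "i \<in> R"
    have "hom (f i r) = (\<Sum>j\<in>C. f i j * hom (w j))"
      unfolding col[OF \<open>i \<in> R\<close>] by (simp add: hom_sum hom_mult fixed)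
    then show "u i * (\<Sum>j\<in>C. f i j * hom (w j)) = u i * f i r" by (simp add: fixed)
  qed simp
  finally have "hom \<theta> = \<theta>" using \<theta>_row by simp
  \<comment> \<open>The factor equals \<open>1 - k * (f c r - \<theta>)\<close>, and
    \<open>f c r - \<theta>\<close> is fixed.\<close>
  then have "k * (f c r - \<theta>) \<noteq> 1"
    by (intro mult_neq_1) (simp add: hom_minus fixed)
  then have e: "?d + k * \<theta> \<noteq> 0" by (simp add: algebra_simps)
  have d: "?d \<noteq> 0" by (rule denom_nonzero)
  have "(\<Sum>j\<in>C. ?g i j * (w j / (?d + k * \<theta>))) = ?g i r" if i: "i \<in> R" for i
  proof -
    have "(\<Sum>j\<in>C. ?g i j * w j) = (\<Sum>j\<in>C. f i j * w j) + f i r * (k / ?d) * \<theta>"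
      unfolding \<theta>_def sum_distrib_left sum.distrib[symmetric]
      by (rule sum.cong) (auto simp: close_gain_def distrib_right mult.assoc)
    also have "\<dots> = f i r * (?d + k * \<theta>) / ?d"
      unfolding col[OF i, symmetric] using d by (simp add: field_simps)
    finally have "(\<Sum>j\<in>C. ?g i j * w j) / (?d + k * \<theta>) = f i r / ?d" using e by simp
    then show ?thesis
      unfolding close_gain_col[of k f, OF d] by (simp add: sum_divide_distrib)
  qed
  then show ?thesis by (intro in_col_spanI[where w = "\<lambda>j. w j / (?d + k * \<theta>)"]) simp
qed

text \<open>The open system arises from the closed one by subtracting its column \<open>r\<close>
  times \<open>k\<close> times the row \<open>c\<close> of \<open>f\<close>. Applying
  \<open>y\<close> to this identity leaves only the multiple \<open>- k\<close> of row
  \<open>c\<close>.\<close>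

lemma row_combination_of_left_kernel:
  assumes y: "\<forall>j\<in>C. (\<Sum>i\<in>R. y i * close_gain k c r f i j) = 0"
      "(\<Sum>i\<in>R. y i * close_gain k c r f i r) = 1"
    and j: "j \<in> C"
  shows "f c j = (\<Sum>i\<in>R. - y i / k * f i j)"
proof -
  let ?g = "close_gain k c r f"
  have d: "1 - k * f c r \<noteq> 0" by (rule denom_nonzero)
  have "f i j = ?g i j - ?g i r * (k * f c j)" for i
    unfolding close_gain_col[of k f, OF d] by (simp add: close_gain_def)
  from arg_cong[OF this]
  have f: "y i * f i j = y i * (?g i j - ?g i r * (k * f c j))" for i .
  have "(\<Sum>i\<in>R. y i * f i j) = (\<Sum>i\<in>R. y i * ?g i j) - (\<Sum>i\<in>R. y i * ?g i r) * (k * f c j)"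
    unfolding sum_distrib_right sum_subtractf[symmetric]
    unfolding f by (simp add: right_diff_distrib mult.assoc)
  also have "\<dots> = - k * f c j" using y j by simp
  finally have "f c j = - (\<Sum>i\<in>R. y i * f i j) / k"
    using k_nonzero by simp
  also have "\<dots> = (\<Sum>i\<in>R. - y i / k * f i j)"
    by (simp add: sum_negf sum_divide_distrib)
  finally show ?thesis .
qed

end

lemma (in free_gain) free_gain_transpose: "free_gain hom k (\<lambda>j i. f i j)"
  by unfold_locales (use fixed moved in auto)

context free_gain
begin

text \<open>It suffices that, in the closed system, adding column \<open>r\<close> or adding row
  \<open>c\<close> does not raise the rank, because open and closed ranks agree after the addition.
  If both additions raised it, separating functionals on both sides would express row
  \<open>c\<close> and column \<open>r\<close> of \<open>f\<close> as combinations, and then column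
  \<open>r\<close> would lie in the span after all.\<close>

lemma rank_on_close_gain_ge:
  assumes fin: "finite R" "finite C"
  shows "rank_on f R (insert r C) \<le> rank_on (close_gain k c r f) R C \<or>
    rank_on f (insert c R) C \<le> rank_on (close_gain k c r f) R C"
proof (cases "in_col_span (close_gain k c r f) R C (\<lambda>i. close_gain k c r f i r)")
  case True
  from rank_on_insert_in_span[OF fin(2) True]
  have "rank_on f R (insert r C) = rank_on (close_gain k c r f) R C"
    by (subst rank_on_close_gain_insert_col[where f = f, OF fin(2) denom_nonzero, symmetric])
  then show ?thesis by simp
next
  case not_col: False
  let ?g = "close_gain k c r f" and ?g' = "close_gain k r c (\<lambda>j i. f i j)"
  interpret tr: free_gain hom k r c "\<lambda>j i. f i j" by (rule free_gain_transpose)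
  obtain y where y: "\<forall>j\<in>C. (\<Sum>i\<in>R. y i * ?g i j) = 0" "(\<Sum>i\<in>R. y i * ?g i r) = 1"
    using Fredholm_alternative[OF fin not_col] by blast
  have "in_col_span ?g' C R (\<lambda>j. ?g' j c)"
  proof (rule ccontr)
    assume "\<not> ?thesis"
    then obtain x where x: "\<forall>i\<in>R. (\<Sum>j\<in>C. x j * ?g' j i) = 0" "(\<Sum>j\<in>C. x j * ?g' j c) = 1"
      using Fredholm_alternative[OF fin(2,1)] by blast
    have "in_col_span ?g R C (\<lambda>i. ?g i r)"
    proof (rule in_col_span_of_combinations)
      show "f c j = (\<Sum>i\<in>R. - y i / k * f i j)" if "j \<in> C" for j
        by (rule row_combination_of_left_kernel[OF y that])
      show "f i r = (\<Sum>j\<in>C. f i j * (- x j / k))" if "i \<in> R" for i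
        using tr.row_combination_of_left_kernel[OF x that] by (simp add: mult.commute)
    qed
    then show False using not_col by contradiction
  qed
  then have "rank_on ?g' C (insert c R) = rank_on ?g' C R"
    by (rule rank_on_insert_in_span[OF fin(1)])
  moreover have tr: "rank_on ?g' C' R' = rank_on ?g R' C'" for C' R'
    by (rule trans[OF arg_cong[OF close_gain_transpose, of "\<lambda>h. rank_on h C' R'"] rank_on_transpose])
  ultimately have "rank_on ?g (insert c R) C = rank_on ?g R C"
    by (simp only: tr)
  then have "rank_on f (insert c R) C = rank_on ?g R C"
    by (subst rank_on_close_gain_insert_row[where f = f, OF fin(1) denom_nonzero, symmetric])
  then show ?thesis by simp
qed

end

section \<open>Closing a list of gains\<close>

fun close_gains :: "('a::field \<times> 'i \<times> 'j) list \<Rightarrow> ('i \<Rightarrow> 'j \<Rightarrow> 'a) \<Rightarrow> 'i \<Rightarrow> 'j \<Rightarrow> 'a" where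
  "close_gains [] f = f"
| "close_gains ((k, c, r) # es) f = close_gain k c r (close_gains es f)"

text \<open>A substitute for algebraic independence of the gains over the field generated by the
  entries of \<open>f\<close>: each gain can be moved by an endomorphism that fixes these entries
  and all other gains.\<close>

definition independent_gains :: "('a::field \<times> 'i \<times> 'j) list \<Rightarrow> ('i \<Rightarrow> 'j \<Rightarrow> 'a) \<Rightarrow> bool" where
  "independent_gains es f \<longleftrightarrow> distinct (map fst es) \<and>
    (\<forall>k \<in> fst ` set es. \<exists>\<sigma>. field_hom \<sigma> \<and> (\<forall>i j. \<sigma> (f i j) = f i j) \<and>
      (\<forall>k' \<in> fst ` set es - {k}. \<sigma> k' = k') \<and> \<sigma> k \<noteq> k)"

lemma independent_gains_tl:
  assumes "independent_gains (e # es) f"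
  shows "independent_gains es f"
  unfolding independent_gains_def
proof (intro conjI ballI)
  show "distinct (map fst es)" using assms by (simp add: independent_gains_def)
  fix k assume "k \<in> fst ` set es"
  then have "k \<in> fst ` set (e # es)" by simp
  then obtain \<sigma> where "field_hom \<sigma>" "\<forall>i j. \<sigma> (f i j) = f i j"
    "\<forall>k' \<in> fst ` set (e # es) - {k}. \<sigma> k' = k'" "\<sigma> k \<noteq> k"
    using assms unfolding independent_gains_def by blast
  then show "\<exists>\<sigma>. field_hom \<sigma> \<and> (\<forall>i j. \<sigma> (f i j) = f i j) \<and>
      (\<forall>k' \<in> fst ` set es - {k}. \<sigma> k' = k') \<and> \<sigma> k \<noteq> k"
    by (intro exI[of _ \<sigma>]) simp
qed

lemma close_gains_fixed:
  assumes "field_hom \<sigma>" "\<And>i j. \<sigma> (f i j) = f i j" "\<And>k. k \<in> fst ` set es \<Longrightarrow> \<sigma> k = k"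
  shows "\<sigma> (close_gains es f i j) = close_gains es f i j"
  using assms(3)
proof (induction es arbitrary: i j)
  case (Cons e es)
  interpret field_hom \<sigma> by fact
  obtain k c r where e: "e = (k, c, r)" by (cases e) auto
  have "\<sigma> (close_gains es f i j) = close_gains es f i j" for i j
    by (rule Cons.IH) (use Cons.prems in auto)
  moreover have "\<sigma> k = k" using Cons.prems e by auto
  ultimately show ?case
    by (simp add: e close_gain_def hom_add hom_mult divide_inverse hom_inverse hom_minus)
qed (use assms in auto)

text \<open>The system with the tail closed is rational in \<open>f\<close> and the tail gains, and
  by distinctness \<open>k\<close> is none of these. An endomorphism that moves only
  \<open>k\<close> thus fixes this system.\<close>

lemma independent_gains_Cons_free:
  assumes "independent_gains ((k, c, r) # es) f"
  obtains \<sigma> where "free_gain \<sigma> k (close_gains es f)"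
proof -
  have k: "k \<in> fst ` set ((k, c, r) # es)" "k \<notin> fst ` set es"
    using assms by (auto simp: independent_gains_def)
  then obtain \<sigma> where "field_hom \<sigma>" "\<forall>i j. \<sigma> (f i j) = f i j" "\<sigma> k \<noteq> k"
    and fix_gains: "\<forall>k' \<in> fst ` set ((k, c, r) # es) - {k}. \<sigma> k' = k'"
    using assms unfolding independent_gains_def by blast
  then have \<sigma>: "field_hom \<sigma>" "\<And>i j. \<sigma> (f i j) = f i j"
    "\<And>k'. k' \<in> fst ` set es \<Longrightarrow> \<sigma> k' = k'" "\<sigma> k \<noteq> k"
    using k by auto
  interpret field_hom \<sigma> by fact
  have "free_gain \<sigma> k (close_gains es f)"
    by unfold_locales (use close_gains_fixed[OF \<sigma>(1-3)] \<sigma>(4) in auto)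
  then show ?thesis by (rule that)
qed

text \<open>The feedback equation with all gains active at once. It links the successive closing of
  single gains to the inverse matrix in the transfer matrix.\<close>

lemma close_gains_fixpoint:
  assumes "independent_gains es f"
  shows "close_gains es f i j = f i j + (\<Sum>(k, c, r)\<leftarrow>es. f i r * k * close_gains es f c j)"
  using assms
proof (induction es arbitrary: i j)
  case (Cons e es)
  obtain k c r where e: "e = (k, c, r)" by (cases e) auto
  let ?g = "close_gains es f" and ?h = "close_gains (e # es) f"
  have "independent_gains ((k, c, r) # es) f" using Cons.prems by (simp add: e)
  then obtain \<sigma> where "free_gain \<sigma> k ?g" by (rule independent_gains_Cons_free)
  then interpret free_gain \<sigma> k c r ?g .
  note IH = Cons.IH[OF independent_gains_tl[OF Cons.prems]]
  have h: "?h i j = ?g i j + ?g i r * (k * ?h c j)" for i j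
    unfolding e close_gains.simps close_gain_row[of k ?g, OF denom_nonzero] by (simp add: close_gain_def)
  let ?s = "\<lambda>j. \<Sum>(k, c, r)\<leftarrow>es. f i r * k * ?g c j"
  \<comment> \<open>The induction hypothesis expands both terms of \<open>h\<close>; afterwards the
    two tail sums recombine by \<open>h\<close> into responses of the fully closed system.\<close>
  have "?h i j = (f i j + ?s j) + (f i r + ?s r) * (k * ?h c j)"
    by (subst h, subst IH[of i j], subst IH[of i r]) (rule refl)
  also have "\<dots> = f i j + (f i r * k * ?h c j + (?s j + ?s r * (k * ?h c j)))"
    by (simp add: algebra_simps)
  also have "?s j + ?s r * (k * ?h c j) = (\<Sum>(k', c', r')\<leftarrow>es. f i r' * k' * (?g c' j + ?g c' r * (k * ?h c j)))"
    unfolding sum_list_mult_const[symmetric] sum_list_addf[symmetric]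
    by (intro arg_cong[where f = sum_list] map_cong) (auto simp: algebra_simps)
  also have "\<dots> = (\<Sum>(k', c', r')\<leftarrow>es. f i r' * k' * ?h c' j)"
    unfolding h[symmetric] ..
  finally show ?case by (simp add: e)
qed simp

text \<open>For gains in \<open>T\<close> the bound by an added column is used, for the others the
  bound by an added row.\<close>

lemma rank_on_close_gains_le:
  assumes "finite R" "finite C"
  shows "rank_on (close_gains es f) R C \<le>
    rank_on f (R \<union> (fst \<circ> snd) ` (set es - T)) (C \<union> (snd \<circ> snd) ` (set es \<inter> T))"
  using assms
proof (induction es arbitrary: R C)
  case (Cons e es)
  obtain k c r where e: "e = (k, c, r)" by (cases e) auto
  let ?g = "close_gains es f"
  show ?case
  proof (cases "e \<in> T")
    case True
    have "rank_on (close_gains (e # es) f) R C \<le> rank_on ?g R (insert r C)"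
      using rank_on_close_gain_le_col[OF Cons.prems(2)] by (simp add: e)
    also have "\<dots> \<le> rank_on f (R \<union> (fst \<circ> snd) ` (set es - T)) (insert r C \<union> (snd \<circ> snd) ` (set es \<inter> T))"
      by (rule Cons.IH) (use Cons.prems in auto)
    finally have le: "rank_on (close_gains (e # es) f) R C \<le> \<dots>" .
    have "r \<in> (snd \<circ> snd) ` (set (e # es) \<inter> T)"
      by (rule image_eqI[of _ _ e]) (use True e in auto)
    then have "rank_on f (R \<union> (fst \<circ> snd) ` (set es - T)) (insert r C \<union> (snd \<circ> snd) ` (set es \<inter> T))
        \<le> rank_on f (R \<union> (fst \<circ> snd) ` (set (e # es) - T)) (C \<union> (snd \<circ> snd) ` (set (e # es) \<inter> T))"
      by (intro rank_on_mono) (use Cons.prems in auto)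
    then show ?thesis using le by (rule order_trans[rotated])
  next
    case False
    have "rank_on (close_gains (e # es) f) R C \<le> rank_on ?g (insert c R) C"
      using rank_on_close_gain_le_row[OF Cons.prems(1)] by (simp add: e)
    also have "\<dots> \<le> rank_on f (insert c R \<union> (fst \<circ> snd) ` (set es - T)) (C \<union> (snd \<circ> snd) ` (set es \<inter> T))"
      by (rule Cons.IH) (use Cons.prems in auto)
    finally have le: "rank_on (close_gains (e # es) f) R C \<le> \<dots>" .
    have "c \<in> (fst \<circ> snd) ` (set (e # es) - T)"
      by (rule image_eqI[of _ _ e]) (use False e in auto)
    then have "rank_on f (insert c R \<union> (fst \<circ> snd) ` (set es - T)) (C \<union> (snd \<circ> snd) ` (set es \<inter> T))
        \<le> rank_on f (R \<union> (fst \<circ> snd) ` (set (e # es) - T)) (C \<union> (snd \<circ> snd) ` (set (e # es) \<inter> T))"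
      by (intro rank_on_mono) (use Cons.prems in auto)
    then show ?thesis using le by (rule order_trans[rotated])
  qed
qed simp

text \<open>\<open>T\<close> records, gain by gain, which alternative of
  \<open>rank_on_close_gain_ge\<close> holds.\<close>

lemma rank_on_close_gains_ge:
  assumes "finite R" "finite C" "independent_gains es f"
  shows "\<exists>T. rank_on f (R \<union> (fst \<circ> snd) ` (set es - T)) (C \<union> (snd \<circ> snd) ` (set es \<inter> T)) \<le>
    rank_on (close_gains es f) R C"
  using assms
proof (induction es arbitrary: R C)
  case (Cons e es)
  obtain k c r where e: "e = (k, c, r)" by (cases e) auto
  let ?g = "close_gains es f"
  have "independent_gains ((k, c, r) # es) f" using Cons.prems(3) by (simp add: e)
  then obtain \<sigma> where "free_gain \<sigma> k ?g" by (rule independent_gains_Cons_free)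
  then interpret free_gain \<sigma> k c r ?g .
  note IH = Cons.IH[OF _ _ independent_gains_tl[OF Cons.prems(3)]]
  \<comment> \<open>Putting \<open>e\<close> into \<open>T\<close> or removing it leaves the choices
    made for the tail intact.\<close>
  have new: "e \<notin> set es"
    using Cons.prems(3) e by (force simp: independent_gains_def)
  consider "rank_on ?g R (insert r C) \<le> rank_on (close_gains (e # es) f) R C"
    | "rank_on ?g (insert c R) C \<le> rank_on (close_gains (e # es) f) R C"
    using rank_on_close_gain_ge[OF Cons.prems(1,2)] by (auto simp: e)
  then show ?case
  proof cases
    case 1
    obtain T where T: "rank_on f (R \<union> (fst \<circ> snd) ` (set es - T)) (insert r C \<union> (snd \<circ> snd) ` (set es \<inter> T))
        \<le> rank_on ?g R (insert r C)"
      using IH[of R "insert r C"] Cons.prems by auto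
    have "rank_on f (R \<union> (fst \<circ> snd) ` (set (e # es) - insert e T)) (C \<union> (snd \<circ> snd) ` (set (e # es) \<inter> insert e T))
      \<le> rank_on f (R \<union> (fst \<circ> snd) ` (set es - T)) (insert r C \<union> (snd \<circ> snd) ` (set es \<inter> T))"
      by (rule rank_on_mono) (use Cons.prems e new in auto)
    then show ?thesis using T 1 by (meson order_trans)
  next
    case 2
    obtain T where T: "rank_on f (insert c R \<union> (fst \<circ> snd) ` (set es - T)) (C \<union> (snd \<circ> snd) ` (set es \<inter> T))
        \<le> rank_on ?g (insert c R) C"
      using IH[of "insert c R" C] Cons.prems by auto
    have "rank_on f (R \<union> (fst \<circ> snd) ` (set (e # es) - (T - {e}))) (C \<union> (snd \<circ> snd) ` (set (e # es) \<inter> (T - {e})))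
      \<le> rank_on f (insert c R \<union> (fst \<circ> snd) ` (set es - T)) (C \<union> (snd \<circ> snd) ` (set es \<inter> T))"
      by (rule rank_on_mono) (use Cons.prems e new in auto)
    then show ?thesis using T 2 by (meson order_trans)
  qed
qed simp

section \<open>Endomorphisms moving a single indeterminate\<close>

text \<open>The substitution of \<open>c\<close> times the indeterminate \<open>x\<close> for
  \<open>x\<close>. It keeps every monomial and only rescales coefficients, so over an integral
  domain it is injective for nonzero \<open>c\<close>.\<close>

definition scale_var ::
    "'b::comm_ring_1 \<Rightarrow> nat \<Rightarrow> ((nat \<Rightarrow>\<^sub>0 nat) \<Rightarrow>\<^sub>0 'b) \<Rightarrow> ((nat \<Rightarrow>\<^sub>0 nat) \<Rightarrow>\<^sub>0 'b)" where
  "scale_var c x = Poly_Mapping.mapp (\<lambda>m a. a * c ^ Poly_Mapping.lookup m x)"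

lemma lookup_scale_var:
  "Poly_Mapping.lookup (scale_var c x p) m = Poly_Mapping.lookup p m * c ^ Poly_Mapping.lookup m x"
  by (simp add: scale_var_def lookup_mapp when_def in_keys_iff)

lemma scale_var_add: "scale_var c x (p + q) = scale_var c x p + scale_var c x q"
  by (rule poly_mapping_eqI) (simp add: lookup_scale_var lookup_add distrib_right)

text \<open>The weight \<open>c\<close> to the power of the exponent of \<open>x\<close> is
  multiplicative in the monomial. The finiteness facts are what \<open>Sum_any\<close> requires for
  the distributive laws.\<close>

lemma scale_var_mult: "scale_var c x (p * q) = scale_var c x p * scale_var c x q"
proof (rule poly_mapping_eqI)
  fix k
  let ?l = Poly_Mapping.lookup and ?S = "scale_var c x"
  have fin_q: "finite {m. (a m when k = l + m) \<noteq> 0}" if "\<And>m. ?l q m = 0 \<Longrightarrow> a m = 0" for a l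
    by (rule finite_subset[OF _ finite_keys[of q]]) (use that in \<open>auto simp: in_keys_iff\<close>)
  have fin_p: "finite {l. ?l p l * b l \<noteq> 0}" for b
    by (rule finite_subset[OF _ finite_keys[of p]]) (auto simp: in_keys_iff)
  have inner: "c ^ ?l l x * (\<Sum>m. ?l (?S q) m when k = l + m) = (\<Sum>m. ?l q m when k = l + m) * c ^ ?l k x" for l
  proof -
    have "c ^ ?l l x * (\<Sum>m. ?l (?S q) m when k = l + m) = (\<Sum>m. c ^ ?l l x * (?l (?S q) m when k = l + m))"
      by (rule Sum_any_right_distrib) (rule fin_q, simp add: lookup_scale_var)
    also have "\<dots> = (\<Sum>m. (?l q m when k = l + m) * c ^ ?l k x)"
      by (rule Sum_any.cong) (auto simp: lookup_scale_var when_def lookup_add power_add)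
    also have "\<dots> = (\<Sum>m. ?l q m when k = l + m) * c ^ ?l k x"
      by (rule Sum_any_left_distrib[symmetric]) (rule fin_q, simp)
    finally show ?thesis .
  qed
  have "?l (?S p * ?S q) k = (\<Sum>l. ?l p l * (c ^ ?l l x * (\<Sum>m. ?l (?S q) m when k = l + m)))"
    by (simp add: lookup_mult lookup_scale_var[of c x p] mult.assoc)
  also have "\<dots> = (\<Sum>l. ?l p l * (\<Sum>m. ?l q m when k = l + m) * c ^ ?l k x)"
    unfolding inner by (simp add: mult.assoc)
  also have "\<dots> = ?l (?S (p * q)) k"
    unfolding lookup_scale_var lookup_mult by (rule Sum_any_left_distrib[symmetric]) (rule fin_p)
  finally show "?l (?S (p * q)) k = ?l (?S p * ?S q) k" ..
qed

lemma scale_var_single: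
  "scale_var c x (Poly_Mapping.single m a) = Poly_Mapping.single m (a * c ^ Poly_Mapping.lookup m x)"
  by (rule poly_mapping_eqI) (simp add: lookup_scale_var lookup_single when_def)

lemma scale_var_one: "scale_var c x 1 = 1"
  by (simp add: scale_var_single flip: single_one)

lemma scale_var_eq_0_iff: "scale_var c x p = 0 \<longleftrightarrow> p = 0" if "c \<noteq> 0" for c :: "'b::idom"
  using that by (simp add: poly_mapping_eq_iff fun_eq_iff lookup_scale_var)

section \<open>Extending homomorphisms to fraction fields\<close>

text \<open>The representation chosen by \<open>SOME\<close> does not affect the value when
  \<open>h\<close> is an injective ring homomorphism.\<close>

definition fract_map :: "('r::idom \<Rightarrow> 's::idom) \<Rightarrow> 'r fract \<Rightarrow> 's fract" where
  "fract_map h y = (SOME z. \<exists>a b. b \<noteq> 0 \<and> y = Fract a b \<and> z = Fract (h a) (h b))"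

locale fract_ring_hom =
  fixes h :: "'r::idom \<Rightarrow> 's::idom"
  assumes add: "h (a + b) = h a + h b" and mult: "h (a * b) = h a * h b" and one: "h 1 = 1"
    and eq_0_iff: "h a = 0 \<longleftrightarrow> a = 0"
begin

lemma fract_map_Fract:
  assumes "b \<noteq> 0"
  shows "fract_map h (Fract a b) = Fract (h a) (h b)"
proof -
  have "\<exists>a' b'. b' \<noteq> 0 \<and> Fract a b = Fract a' b' \<and> fract_map h (Fract a b) = Fract (h a') (h b')"
    unfolding fract_map_def by (rule someI[of _ "Fract (h a) (h b)"]) (use assms in blast)
  then obtain a' b' where *: "b' \<noteq> 0" "Fract a b = Fract a' b'"
      "fract_map h (Fract a b) = Fract (h a') (h b')"
    by blast
  have "a * b' = a' * b" using * assms by (simp add: eq_fract)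
  then have "h a * h b' = h a' * h b" by (metis mult)
  then show ?thesis using * assms by (simp add: eq_fract eq_0_iff)
qed

lemma field_hom_fract_map: "field_hom (fract_map h)"
proof unfold_locales
  show "fract_map h 0 = 0" using fract_map_Fract[of 1 0]
    by (simp add: Zero_fract_def[symmetric] one) (metis Zero_fract_def eq_0_iff)
  show "fract_map h 1 = 1" using fract_map_Fract[of 1 1] by (simp add: One_fract_def one)
  fix x y :: "'r fract"
  obtain a b c d where xy: "x = Fract a b" "b \<noteq> 0" "y = Fract c d" "d \<noteq> 0"
    by (metis Fract_cases)
  show "fract_map h (x + y) = fract_map h x + fract_map h y"
    using xy by (simp add: fract_map_Fract add mult eq_0_iff)
  show "fract_map h (x * y) = fract_map h x * fract_map h y"
    using xy by (simp add: fract_map_Fract mult eq_0_iff)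
qed

end

lemma fract_ring_hom_scale_var:
  "c \<noteq> 0 \<Longrightarrow> fract_ring_hom (scale_var c x)" for c :: "'b::idom"
  by unfold_locales (simp_all add: scale_var_add scale_var_mult scale_var_one scale_var_eq_0_iff)

lemma field_hom_gain_const: "field_hom (gain_const :: 'f::field ratfun \<Rightarrow> _)"
  by unfold_locales
    (simp_all add: gain_const_def single_add fract_collapse mult_single)

lemma obtain_gain_endomorphism:
  obtains \<sigma> :: "'f::field gain_ratfun \<Rightarrow> 'f gain_ratfun"
  where "field_hom \<sigma>" "\<And>a. \<sigma> (gain_const a) = gain_const a"
    "\<And>y. y \<noteq> x \<Longrightarrow> \<sigma> (indet y) = indet y" "\<sigma> (indet x) \<noteq> indet x"
proof -
  \<comment> \<open>The scaling constant must differ from 0 and 1. The variable \<open>z\<close>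
    does so over every ground field, even the one with two elements.\<close>
  define c :: "'f ratfun" where "c = Fract [:0, 1:] 1"
  have c: "c \<noteq> 0" "c \<noteq> 1"
    by (simp_all add: c_def Zero_fract_def One_fract_def eq_fract one_pCons)
  interpret fract_ring_hom "scale_var c x" using c(1) by (rule fract_ring_hom_scale_var)
  show ?thesis
  proof
    show "field_hom (fract_map (scale_var c x))" by (rule field_hom_fract_map)
    show "fract_map (scale_var c x) (gain_const a) = gain_const a" for a
      by (simp add: gain_const_def fract_map_Fract one scale_var_single)
    show "fract_map (scale_var c x) (indet y) = indet y" if "y \<noteq> x" for y
      using that by (simp add: indet_def fract_map_Fract one scale_var_single lookup_single)
    have "Poly_Mapping.single (Poly_Mapping.single x 1) c \<noteq> Poly_Mapping.single (Poly_Mapping.single x (1::nat)) 1"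
      using c(2) by (metis lookup_single_eq)
    then show "fract_map (scale_var c x) (indet x) \<noteq> indet x"
      by (simp add: indet_def fract_map_Fract one scale_var_single eq_fract)
  qed
qed

section \<open>Networks\<close>

lemma set_block_index: "set (block_index d js) = {(j, a). j \<in> set js \<and> a < d j}"
  by (auto simp: block_index_def)

lemma distinct_block_index: "distinct js \<Longrightarrow> distinct (block_index d js)"
proof (induction js)
  case (Cons j js)
  have "set (map (Pair j) [0..<d j]) \<inter> set (block_index d js) = {}"
    using Cons.prems by (auto simp: set_block_index)
  then show ?case using Cons by (simp add: block_index_def distinct_map inj_on_def)
qed (simp add: block_index_def)

lemma block_mat_eq_mat_on:
  "block_mat nr js nc is B =
    mat_on (\<lambda>(j, a) (i, b). B j i $$ (a, b)) (block_index nr js) (block_index nc is)"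
  by (simp add: block_mat_def mat_on_def Let_def case_prod_beta')

locale network =
  fixes v :: nat and d_in d_out :: "nat \<Rightarrow> nat" and H :: "nat \<Rightarrow> nat \<Rightarrow> 'f::field ratfun mat"
  assumes lti: "lti_network v d_in d_out H"
begin

definition gain :: "nat \<Rightarrow> nat \<Rightarrow> nat \<Rightarrow> 'f gain_ratfun" where
  "gain i b a = indet (prod_encode (i, prod_encode (b, a)))"

text \<open>All channel matrices in one array, with rows (node, output) and columns (node, input);
  every cut matrix is a submatrix of it.\<close>

definition channel :: "nat \<times> nat \<Rightarrow> nat \<times> nat \<Rightarrow> 'f ratfun" where
  "channel = (\<lambda>(j, a) (i, b). H i j $$ (a, b))"

definition lifted_channel :: "nat \<times> nat \<Rightarrow> nat \<times> nat \<Rightarrow> 'f gain_ratfun" where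
  "lifted_channel p q = gain_const (channel p q)"

definition gain_index :: "(nat \<times> nat \<times> nat) set" where
  "gain_index = (SIGMA i:{1..v}. {..<d_in i} \<times> {..<d_out i})"

text \<open>Entry \<open>(b, a)\<close> of a gain matrix reads output \<open>a\<close> of the relay,
  a row of the system, and drives its input \<open>b\<close>, a column.\<close>

definition gain_entry :: "nat \<times> nat \<times> nat \<Rightarrow> 'f gain_ratfun \<times> (nat \<times> nat) \<times> (nat \<times> nat)" where
  "gain_entry = (\<lambda>(i, b, a). (gain i b a, (i, a), (i, b)))"

definition gain_list :: "('f gain_ratfun \<times> (nat \<times> nat) \<times> (nat \<times> nat)) list" where
  "gain_list = map gain_entry (SOME xs. distinct xs \<and> set xs = gain_index)"

lemma finite_gain_index: "finite gain_index"
  by (auto simp: gain_index_def)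

lemma gain_list_ex: "\<exists>xs. distinct xs \<and> set xs = gain_index \<and> gain_list = map gain_entry xs"
proof -
  have "\<exists>xs. distinct xs \<and> set xs = gain_index"
    using finite_distinct_list[OF finite_gain_index] by blast
  from someI_ex[OF this] show ?thesis unfolding gain_list_def by blast
qed

lemma set_gain_list: "set gain_list = gain_entry ` gain_index"
  using gain_list_ex by auto

lemma indet_inject: "indet x = (indet y :: 'f gain_ratfun) \<longleftrightarrow> x = y"
proof
  assume *: "indet x = (indet y :: 'f gain_ratfun)"
  obtain \<sigma> :: "'f gain_ratfun \<Rightarrow> 'f gain_ratfun"
    where "\<And>y. y \<noteq> x \<Longrightarrow> \<sigma> (indet y) = indet y" "\<sigma> (indet x) \<noteq> indet x"
    using obtain_gain_endomorphism[of x] by blast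
  with * show "x = y" by metis
qed simp

lemma gain_inject: "gain i b a = gain i' b' a' \<longleftrightarrow> i = i' \<and> b = b' \<and> a = a'"
  by (auto simp: gain_def indet_inject prod_encode_eq)

lemma independent_gain_list: "independent_gains gain_list lifted_channel"
  unfolding independent_gains_def
proof (intro conjI ballI)
  obtain xs where xs: "distinct xs" "gain_list = map gain_entry xs" using gain_list_ex by blast
  have "inj (fst \<circ> gain_entry)"
    by (auto simp: inj_def gain_entry_def gain_inject)
  then show "distinct (map fst gain_list)"
    using xs by (simp add: distinct_map inj_on_subset[OF _ subset_UNIV])
  fix k assume "k \<in> fst ` set gain_list"
  then obtain i b a where k: "k = gain i b a" by (auto simp: set_gain_list gain_entry_def)
  obtain \<sigma> :: "'f gain_ratfun \<Rightarrow> 'f gain_ratfun"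
    where \<sigma>: "field_hom \<sigma>" "\<And>a. \<sigma> (gain_const a) = gain_const a"
      "\<And>y. y \<noteq> prod_encode (i, prod_encode (b, a)) \<Longrightarrow> \<sigma> (indet y) = indet y"
      "\<sigma> (indet (prod_encode (i, prod_encode (b, a)))) \<noteq> indet (prod_encode (i, prod_encode (b, a)))"
    using obtain_gain_endomorphism[of "prod_encode (i, prod_encode (b, a))"] by blast
  have "\<sigma> k' = k'" if k'_in: "k' \<in> fst ` set gain_list - {k}" for k'
  proof -
    obtain i' b' a' where k': "k' = gain i' b' a'"
      using k'_in by (auto simp: set_gain_list gain_entry_def)
    then have "gain i' b' a' \<noteq> gain i b a" using k'_in k by auto
    then show ?thesis unfolding k' gain_def by (intro \<sigma>(3)) auto
  qed
  then show "\<exists>\<sigma>. field_hom \<sigma> \<and> (\<forall>p q. \<sigma> (lifted_channel p q) = lifted_channel p q) \<and>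
      (\<forall>k' \<in> fst ` set gain_list - {k}. \<sigma> k' = k') \<and> \<sigma> k \<noteq> k"
    using \<sigma>(1,2,4) k by (intro exI[of _ \<sigma>]) (simp add: lifted_channel_def gain_def)
qed

section \<open>The closed loop and the transfer matrix\<close>

definition response :: "nat \<times> nat \<Rightarrow> nat \<times> nat \<Rightarrow> 'f gain_ratfun" where
  "response = close_gains gain_list lifted_channel"

definition relay_outputs :: "(nat \<times> nat) set" where
  "relay_outputs = (SIGMA i:{1..v}. {..<d_out i})"

text \<open>The product of \<open>f\<close> with the block diagonal matrix of all gain matrices; its
  columns are indexed by relay outputs.\<close>

definition after_gain ::
    "(nat \<times> nat \<Rightarrow> nat \<times> nat \<Rightarrow> 'f gain_ratfun) \<Rightarrow> nat \<times> nat \<Rightarrow> nat \<times> nat \<Rightarrow> 'f gain_ratfun" where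
  "after_gain f p = (\<lambda>(i, a). \<Sum>b<d_in i. f p (i, b) * gain i b a)"

lemma response_fixpoint:
  "response p q = lifted_channel p q + (\<Sum>u\<in>relay_outputs. after_gain lifted_channel p u * response u q)"
proof -
  obtain xs where xs: "distinct xs" "set xs = gain_index" "gain_list = map gain_entry xs"
    using gain_list_ex by blast
  have "(\<Sum>(k, c, r)\<leftarrow>gain_list. lifted_channel p r * k * response c q)
    = (\<Sum>(i, b, a)\<in>gain_index. lifted_channel p (i, b) * gain i b a * response (i, a) q)"
    unfolding xs(3) map_map xs(2)[symmetric]
    by (subst sum_list_distinct_conv_sum_set[OF xs(1)]) (auto simp: gain_entry_def intro!: sum.cong)
  also have "\<dots> = (\<Sum>i\<in>{1..v}. \<Sum>b<d_in i. \<Sum>a<d_out i. lifted_channel p (i, b) * gain i b a * response (i, a) q)"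
    unfolding gain_index_def by (simp add: sum.Sigma sum.cartesian_product)
  also have "\<dots> = (\<Sum>i\<in>{1..v}. \<Sum>a<d_out i. after_gain lifted_channel p (i, a) * response (i, a) q)"
    by (rule sum.cong[OF refl], subst sum.swap) (simp add: after_gain_def sum_distrib_right)
  also have "\<dots> = (\<Sum>u\<in>relay_outputs. after_gain lifted_channel p u * response u q)"
    unfolding relay_outputs_def by (subst sum.Sigma) (auto intro!: sum.cong)
  finally show ?thesis
    unfolding response_def using close_gains_fixpoint[OF independent_gain_list, of p q] by simp
qed

lemma after_gain_response_fixpoint:
  "after_gain response p w = after_gain lifted_channel p w + (\<Sum>u\<in>relay_outputs. after_gain lifted_channel p u * after_gain response u w)"
proof -
  obtain i a where w: "w = (i, a)" by fastforce
  have "after_gain response p w = (\<Sum>b<d_in i. lifted_channel p (i, b) * gain i b a)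
      + (\<Sum>b<d_in i. \<Sum>u\<in>relay_outputs. after_gain lifted_channel p u * response u (i, b) * gain i b a)"
    unfolding sum.distrib[symmetric] w after_gain_def[of response] prod.case
    by (rule sum.cong[OF refl], subst response_fixpoint) (simp add: distrib_right sum_distrib_right)
  also have "(\<Sum>b<d_in i. \<Sum>u\<in>relay_outputs. after_gain lifted_channel p u * response u (i, b) * gain i b a)
      = (\<Sum>u\<in>relay_outputs. after_gain lifted_channel p u * after_gain response u w)"
    by (subst sum.swap) (simp add: w after_gain_def[of response] sum_distrib_left mult.assoc)
  also have "(\<Sum>b<d_in i. lifted_channel p (i, b) * gain i b a) = after_gain lifted_channel p w"
    by (simp add: w after_gain_def)
  finally show ?thesis .
qed

abbreviation "relay_out_list \<equiv> block_index d_out [1..<v + 1]"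
abbreviation "rx_list \<equiv> block_index d_out [v + 1]"
abbreviation "tx_list \<equiv> block_index d_in [0]"

lemma relay_out_list: "distinct relay_out_list" "set relay_out_list = relay_outputs"
  by (auto simp: distinct_block_index set_block_index relay_outputs_def)

lemma channel_carrier: "i \<le> v \<Longrightarrow> 1 \<le> j \<Longrightarrow> j \<le> v + 1 \<Longrightarrow> H i j \<in> carrier_mat (d_out j) (d_in i)"
  using lti by (auto simp: lti_network_def)

lemma block_mat_gained:
  assumes "set js \<subseteq> {1..v + 1}"
  shows "block_mat d_out js d_out [1..<v + 1] (\<lambda>j i. map_mat gain_const (H i j) * gain_mat d_in d_out i)
    = mat_on (after_gain lifted_channel) (block_index d_out js) relay_out_list"
  unfolding block_mat_eq_mat_on
proof (rule mat_on_cong)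
  fix p q assume "p \<in> set (block_index d_out js)" "q \<in> set relay_out_list"
  then obtain j a i c where pq: "p = (j, a)" "q = (i, c)"
    and *: "j \<in> set js" "a < d_out j" "1 \<le> i" "i \<le> v" "c < d_out i"
    by (auto simp: set_block_index)
  have "(map_mat gain_const (H i j) * gain_mat d_in d_out i) $$ (a, c) = after_gain lifted_channel (j, a) (i, c)"
    using channel_carrier[of i j] assms *
    by (auto simp: scalar_prod_def gain_mat_def after_gain_def lifted_channel_def channel_def gain_def
      atLeast0LessThan intro!: sum.cong)
  then show "(case p of (j, a) \<Rightarrow> \<lambda>(i, b). (map_mat gain_const (H i j) * gain_mat d_in d_out i) $$ (a, b)) q
    = after_gain lifted_channel p q"
    by (simp add: pq)
qed

lemma block_mat_from_tx:
  assumes "set js \<subseteq> {1..v + 1}"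
  shows "block_mat d_out js d_in [0] (\<lambda>j i. map_mat gain_const (H i j))
    = mat_on lifted_channel (block_index d_out js) tx_list"
  unfolding block_mat_eq_mat_on
proof (rule mat_on_cong)
  fix p q assume "p \<in> set (block_index d_out js)" "q \<in> set tx_list"
  then obtain j a b where pq: "p = (j, a)" "q = (0, b)" and *: "j \<in> set js" "a < d_out j" "b < d_in 0"
    by (auto simp: set_block_index)
  then show "(case p of (j, a) \<Rightarrow> \<lambda>(i, b). map_mat gain_const (H i j) $$ (a, b)) q = lifted_channel p q"
    using channel_carrier[of 0 j] assms by (auto simp: lifted_channel_def channel_def)
qed

lemma direct_channel: "map_mat gain_const (H 0 (v + 1)) = mat_on lifted_channel rx_list tx_list"
  using channel_carrier[of 0 "v + 1"]
  by (intro eq_matI) (auto simp: block_index_def lifted_channel_def channel_def)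

text \<open>The two fixpoint equations solve the loop explicitly: \<open>1\<^sub>m n + Z\<close> is
  the inverse of \<open>M\<close>, so \<open>mat_inverse\<close> succeeds, and the inverse maps
  \<open>B\<close> to \<open>Y\<close>.\<close>

lemma transfer_mat_eq: "transfer_mat v d_in d_out H = mat_on response rx_list tx_list"
proof -
  let ?U = relay_out_list
  define n m l where "n = length ?U" and "m = length tx_list" and "l = length rx_list"
  define L where "L = mat_on (after_gain lifted_channel) ?U ?U"
  define A where "A = mat_on (after_gain lifted_channel) rx_list ?U"
  define B where "B = mat_on lifted_channel ?U tx_list"
  define Y where "Y = mat_on response ?U tx_list"
  define Z where "Z = mat_on (after_gain response) ?U ?U"
  have carr: "L \<in> carrier_mat n n" "Z \<in> carrier_mat n n" "A \<in> carrier_mat l n"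
      "B \<in> carrier_mat n m" "Y \<in> carrier_mat n m"
    unfolding L_def A_def B_def Y_def Z_def n_def m_def l_def by (rule mat_on_carrier)+
  \<comment> \<open>At the relay outputs this reads \<open>Y = B + L * Y\<close>; at the receiver
    outputs it is the final formula for the transfer matrix.\<close>
  have response: "mat_on response P tx_list = mat_on lifted_channel P tx_list + mat_on (after_gain lifted_channel) P ?U * Y" for P
    unfolding Y_def mat_on_mult[OF relay_out_list(1)] relay_out_list(2) mat_on_add[symmetric]
    by (rule mat_on_cong) (rule response_fixpoint)
  have Z: "Z = L + L * Z"
    unfolding Z_def L_def mat_on_mult[OF relay_out_list(1)] relay_out_list(2) mat_on_add[symmetric]
    by (rule mat_on_cong) (rule after_gain_response_fixpoint)
  define M where "M = 1\<^sub>m n - L"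
  have M: "M \<in> carrier_mat n n" unfolding M_def by (rule minus_carrier_mat) (rule carr(1))
  have Z1: "1\<^sub>m n + Z \<in> carrier_mat n n" by (rule add_carrier_mat) (rule carr(2))
  have cancel: "(X + W) - W = X" if "X \<in> carrier_mat p q" "W \<in> carrier_mat p q"
    for X W :: "'f gain_ratfun mat" and p q
    using that by (intro eq_matI) auto
  have "M * (1\<^sub>m n + Z) = (1\<^sub>m n + Z) - L * (1\<^sub>m n + Z)"
    unfolding M_def minus_mult_distrib_mat[OF one_carrier_mat carr(1) Z1] left_mult_one_mat[OF Z1] ..
  also have "L * (1\<^sub>m n + Z) = L + L * Z"
    unfolding mult_add_distrib_mat[OF carr(1) one_carrier_mat carr(2)] using carr(1) by simp
  also have "(1\<^sub>m n + Z) - (L + L * Z) = 1\<^sub>m n"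
    unfolding Z[symmetric] using carr by (intro cancel) auto
  finally have inv: "M * (1\<^sub>m n + Z) = 1\<^sub>m n" .
  have inv': "(1\<^sub>m n + Z) * M = 1\<^sub>m n"
    by (rule mat_mult_left_right_inverse[OF M _ inv]) (use carr in simp)
  have "M \<in> Units (ring_mat TYPE('f gain_ratfun) n ())"
    unfolding Units_def using inv inv' M carr
    by (auto simp: ring_mat_simps intro!: bexI[of _ "1\<^sub>m n + Z"])
  then obtain N where N: "mat_inverse M = Some N" using mat_inverse(1)[OF M, where b = "()"] by (cases "mat_inverse M") auto
  have N': "N * M = 1\<^sub>m n" "N \<in> carrier_mat n n" using mat_inverse(2)[OF M N] by auto
  have "M * Y = Y - L * Y"
    unfolding M_def minus_mult_distrib_mat[OF one_carrier_mat carr(1,5)] using carr(5) by simp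
  also have "\<dots> = (B + L * Y) - L * Y"
    using response[of ?U] by (simp add: Y_def B_def L_def)
  also have "\<dots> = B" using carr by (intro cancel) auto
  finally have "N * B = (N * M) * Y" by (simp only: assoc_mult_mat[OF N'(2) M carr(5)])
  then have NB: "N * B = Y" using N' carr by simp
  have dim: "dim_row (mat_on (after_gain lifted_channel) ?U ?U) = n" by (simp only: dim_mat_on n_def)
  have "transfer_mat v d_in d_out H = mat_on lifted_channel rx_list tx_list + A * the (mat_inverse M) * B"
    unfolding transfer_mat_def Let_def M_def L_def A_def B_def
    by (subst block_mat_gained, force, subst block_mat_gained, force, subst block_mat_gained, force,
        subst block_mat_from_tx, force, subst direct_channel, subst dim, rule refl)
  also have "A * the (mat_inverse M) * B = A * Y"
    unfolding N using carr N' by (simp add: assoc_mult_mat[of _ l n] NB)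
  also have "mat_on lifted_channel rx_list tx_list + A * Y = mat_on response rx_list tx_list"
    unfolding A_def by (rule response[symmetric])
  finally show ?thesis .
qed

lemma rank_transfer_mat:
  "mat_rank (transfer_mat v d_in d_out H) = rank_on response (set rx_list) (set tx_list)"
  by (simp add: transfer_mat_eq mat_rank_mat_on)

section \<open>Cuts and the two inequalities\<close>

definition cut_rows :: "nat set \<Rightarrow> (nat \<times> nat) set" where
  "cut_rows V = (SIGMA j:{0..v + 1} - V. {..<d_out j})"

definition cut_cols :: "nat set \<Rightarrow> (nat \<times> nat) set" where
  "cut_cols V = (SIGMA i:V. {..<d_in i})"

lemma rank_cut_mat:
  assumes "V \<in> cuts v"
  shows "mat_rank (cut_mat v d_in d_out H V) = rank_on lifted_channel (cut_rows V) (cut_cols V)"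
proof -
  have fin: "finite V" using assms by (auto simp: cuts_def intro: finite_subset)
  interpret field_hom "gain_const :: 'f ratfun \<Rightarrow> _" by (rule field_hom_gain_const)
  have "finite (cut_rows V)" "finite (cut_cols V)" using fin by (simp_all add: cut_rows_def cut_cols_def)
  then have "rank_on lifted_channel (cut_rows V) (cut_cols V) = rank_on channel (cut_rows V) (cut_cols V)"
    using rank_on_hom[of "cut_rows V" "cut_cols V" channel] by (simp add: lifted_channel_def[abs_def])
  moreover have "set (block_index d_out (sorted_list_of_set ({0..v + 1} - V))) = cut_rows V"
      "set (block_index d_in (sorted_list_of_set V)) = cut_cols V"
    using fin by (auto simp: set_block_index cut_rows_def cut_cols_def)
  ultimately show ?thesis
    by (simp add: cut_mat_def block_mat_eq_mat_on mat_rank_mat_on channel_def)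
qed

lemma rank_transfer_mat_le_cut:
  assumes "V \<in> cuts v"
  shows "mat_rank (transfer_mat v d_in d_out H) \<le> mat_rank (cut_mat v d_in d_out H V)"
proof -
  have V: "V \<subseteq> {0..v + 1}" "0 \<in> V" "v + 1 \<notin> V" "finite V"
    using assms by (auto simp: cuts_def intro: finite_subset)
  \<comment> \<open>The gains of the relays in \<open>V\<close>: these relays contribute inputs as
    columns, the others outputs as rows. Only inclusions result, since a relay without inputs or
    without outputs has no gains.\<close>
  define T :: "('f gain_ratfun \<times> (nat \<times> nat) \<times> (nat \<times> nat)) set"
    where "T = {e. fst (fst (snd e)) \<in> V}"
  have T: "gain_entry (i, b, a) \<in> T \<longleftrightarrow> i \<in> V" for i b a
    by (auto simp: T_def gain_entry_def)
  have "rank_on response (set rx_list) (set tx_list)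
      \<le> rank_on lifted_channel (set rx_list \<union> (fst \<circ> snd) ` (set gain_list - T))
          (set tx_list \<union> (snd \<circ> snd) ` (set gain_list \<inter> T))"
    unfolding response_def by (rule rank_on_close_gains_le) auto
  also have "\<dots> \<le> rank_on lifted_channel (cut_rows V) (cut_cols V)"
  proof (rule rank_on_mono)
    show "finite (cut_cols V)" using V by (simp add: cut_cols_def)
    show "set rx_list \<union> (fst \<circ> snd) ` (set gain_list - T) \<subseteq> cut_rows V"
    proof -
      have "(fst \<circ> snd) e \<in> cut_rows V" if "e \<in> set gain_list - T" for e
      proof -
        obtain i b a where "e = gain_entry (i, b, a)" "(i, b, a) \<in> gain_index"
          using \<open>e \<in> set gain_list - T\<close> by (auto simp: set_gain_list)
        then show ?thesis using \<open>e \<in> set gain_list - T\<close> T[of i b a]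
          by (auto simp: gain_entry_def gain_index_def cut_rows_def)
      qed
      then show ?thesis using V by (auto simp: set_block_index cut_rows_def)
    qed
    show "set tx_list \<union> (snd \<circ> snd) ` (set gain_list \<inter> T) \<subseteq> cut_cols V"
    proof -
      have "(snd \<circ> snd) e \<in> cut_cols V" if "e \<in> set gain_list \<inter> T" for e
      proof -
        obtain i b a where "e = gain_entry (i, b, a)" "(i, b, a) \<in> gain_index"
          using \<open>e \<in> set gain_list \<inter> T\<close> by (auto simp: set_gain_list)
        then show ?thesis using \<open>e \<in> set gain_list \<inter> T\<close> T[of i b a]
          by (auto simp: gain_entry_def gain_index_def cut_cols_def)
      qed
      then show ?thesis using V by (auto simp: set_block_index cut_cols_def)
    qed
  qed
  finally show ?thesis using rank_transfer_mat rank_cut_mat[OF assms] by simp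
qed

lemma ex_cut_le_rank_transfer_mat:
  "\<exists>V\<in>cuts v. mat_rank (cut_mat v d_in d_out H V) \<le> mat_rank (transfer_mat v d_in d_out H)"
proof -
  obtain T where T: "rank_on lifted_channel (set rx_list \<union> (fst \<circ> snd) ` (set gain_list - T))
      (set tx_list \<union> (snd \<circ> snd) ` (set gain_list \<inter> T)) \<le> rank_on response (set rx_list) (set tx_list)"
    unfolding response_def
    using rank_on_close_gains_ge[OF finite_set finite_set independent_gain_list] by blast
  \<comment> \<open>A relay belongs to \<open>V\<close> when each of its inputs is driven by a gain
    in \<open>T\<close>. Otherwise all gains into some input \<open>b\<close> avoid
    \<open>T\<close>, and together they read every output. A relay without inputs falls into
    \<open>V\<close> and adds no columns; one with inputs but no outputs stays outside and adds no
    rows.\<close>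
  define V where "V = insert 0 {i \<in> {1..v}. \<forall>b<d_in i. \<exists>a<d_out i. gain_entry (i, b, a) \<in> T}"
  have V: "V \<in> cuts v" by (auto simp: V_def cuts_def)
  have "cut_rows V \<subseteq> set rx_list \<union> (fst \<circ> snd) ` (set gain_list - T)"
  proof
    fix p assume "p \<in> cut_rows V"
    then obtain j a where p: "p = (j, a)" "j \<le> v + 1" "j \<notin> V" "a < d_out j"
      by (auto simp: cut_rows_def)
    show "p \<in> set rx_list \<union> (fst \<circ> snd) ` (set gain_list - T)"
    proof (cases "j = v + 1")
      case True
      then show ?thesis using p by (auto simp: set_block_index)
    next
      case False
      then have j: "j \<in> {1..v}" using p by (cases "j = 0") (auto simp: V_def)
      then obtain b where b: "b < d_in j" "\<forall>a<d_out j. gain_entry (j, b, a) \<notin> T"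
        using p(3) unfolding V_def by blast
      have "p = (fst \<circ> snd) (gain_entry (j, b, a))" by (simp add: p gain_entry_def)
      moreover have "gain_entry (j, b, a) \<in> set gain_list - T"
        using b p j by (auto simp: set_gain_list gain_index_def)
      ultimately show ?thesis by blast
    qed
  qed
  moreover have "cut_cols V \<subseteq> set tx_list \<union> (snd \<circ> snd) ` (set gain_list \<inter> T)"
  proof
    fix q assume "q \<in> cut_cols V"
    then obtain i b where q: "q = (i, b)" "i \<in> V" "b < d_in i" by (auto simp: cut_cols_def)
    show "q \<in> set tx_list \<union> (snd \<circ> snd) ` (set gain_list \<inter> T)"
    proof (cases "i = 0")
      case True
      then show ?thesis using q by (auto simp: set_block_index)
    next
      case False
      then obtain a where a: "a < d_out i" "gain_entry (i, b, a) \<in> T" "i \<in> {1..v}"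
        using q by (auto simp: V_def)
      have "q = (snd \<circ> snd) (gain_entry (i, b, a))" by (simp add: q gain_entry_def)
      moreover have "gain_entry (i, b, a) \<in> set gain_list \<inter> T"
        using a q by (auto simp: set_gain_list gain_index_def)
      ultimately show ?thesis by blast
    qed
  qed
  ultimately have "rank_on lifted_channel (cut_rows V) (cut_cols V) \<le> rank_on response (set rx_list) (set tx_list)"
    by (intro order_trans[OF rank_on_mono T]) auto
  then show ?thesis using V rank_transfer_mat rank_cut_mat by (intro bexI[of _ V]) simp_all
qed

end

theorem theorem2:
  fixes v :: nat
    and d_in d_out :: "nat \<Rightarrow> nat"
    and H :: "nat \<Rightarrow> nat \<Rightarrow> 'f::field ratfun mat"
  assumes "lti_network v d_in d_out H"
  shows "mat_rank (transfer_mat v d_in d_out H) =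
    Min ((\<lambda>V. mat_rank (cut_mat v d_in d_out H V)) ` cuts v)"
proof -
  interpret network v d_in d_out H by unfold_locales fact
  have fin: "finite (cuts v)"
    by (rule finite_subset[of _ "Pow {0..v + 1}"]) (auto simp: cuts_def)
  obtain V where V: "V \<in> cuts v"
    "mat_rank (cut_mat v d_in d_out H V) \<le> mat_rank (transfer_mat v d_in d_out H)"
    using ex_cut_le_rank_transfer_mat by blast
  then have "mat_rank (transfer_mat v d_in d_out H) = mat_rank (cut_mat v d_in d_out H V)"
    using rank_transfer_mat_le_cut by (intro antisym)
  then show ?thesis
    using fin V(1) rank_transfer_mat_le_cut by (intro Min_eqI[symmetric]) auto
qed

end
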